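(* Let $R$ be a semi-local ring with $2\in R^\times$. Then the symmetric monoidal category $(\mathrm{Quad}(R),\perp,0)$ of non-singular quadratic modules over $R$ is homogeneous; that is, the zero module $0$ is initial and for all objects $X,Y$: (H1) the group $\mathrm{Aut}(Y)$ acts transitively by postcomposition on $\mathrm{Hom}(X,Y)$; and (H2) the homomorphism $\mathrm{Aut}(X)\to\mathrm{Aut}(X\perp Y)$, $f\mapsto f\perp\mathrm{id}_Y$, is injective with image the set of $\varphi\in\mathrm{Aut}(X\perp Y)$ satisfying $\varphi\circ\iota_Y=\iota_Y$, where $\iota_Y:Y\to X\perp Y$ is $y\mapsto(0,y)$.
   Context: A quadratic module over a commutative ring $R$ is a pair $(V,q)$ with $V$ a finitely generated projective $R$-module and $q:V\to R$ with $q(ax)=a^2q(x)$ and $B_q(x,y)=q(x+y)-q(x)-q(y)$ bilinear; it is non-singular if $x\mapsto B_q(x,-)$ is an isomorphism $V\to\mathrm{Hom}_R(V,R)$. $\mathrm{Quad}(R)$ is the category of non-singular quadratic modules with morphisms the $R$-linear maps $f:(V,q)\to(V',q')$ with $q'(f(v))=q(v)$. The orthogonal sum is $(V_1,q_1)\perp(V_2,q_2)=(V_1\oplus V_2,(x_1,x_2)\mapsto q_1(x_1)+q_2(x_2))$, with $f_1\perp f_2=f_1\oplus f_2$; the unit is the zero module. A ring is semi-local if it has finitely many maximal ideals. *)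

theory Defs
  imports Complex_Main "HOL-Library.FuncSet" "HOL-Library.Product_Plus"
begin

text \<open>The ring R is the whole type 'a (class comm_ring_1).  An R-module is represented as a
  subspace V (carrier set) of an ambient R-module given by a scalar multiplication
  s :: 'a => 'v => 'v on a type 'v of class ab_group_add (locale module from HOL Modules).\<close>

definition ring_ideal :: "'a::comm_ring_1 set \<Rightarrow> bool" where
  "ring_ideal I \<longleftrightarrow> 0 \<in> I \<and> (\<forall>x\<in>I. \<forall>y\<in>I. x + y \<in> I) \<and> (\<forall>r. \<forall>x\<in>I. r * x \<in> I)"

definition maximal_ideal :: "'a::comm_ring_1 set \<Rightarrow> bool" where
  "maximal_ideal m \<longleftrightarrow> ring_ideal m \<and> m \<noteq> UNIV \<and>
     (\<forall>J. ring_ideal J \<and> m \<subseteq> J \<longrightarrow> J = m \<or> J = UNIV)"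

definition semi_local :: "'a::comm_ring_1 itself \<Rightarrow> bool" where
  "semi_local _ \<longleftrightarrow> finite {m::'a set. maximal_ideal m}"

definition lin_on :: "('a::comm_ring_1 \<Rightarrow> 'v::ab_group_add \<Rightarrow> 'v) \<Rightarrow> ('a \<Rightarrow> 'w::ab_group_add \<Rightarrow> 'w)
    \<Rightarrow> 'v set \<Rightarrow> ('v \<Rightarrow> 'w) \<Rightarrow> bool" where
  "lin_on s t V f \<longleftrightarrow> (\<forall>x\<in>V. \<forall>y\<in>V. f (x + y) = f x + f y) \<and> (\<forall>a. \<forall>x\<in>V. f (s a x) = t a (f x))"

definition fin_gen :: "('a::comm_ring_1 \<Rightarrow> 'v::ab_group_add \<Rightarrow> 'v) \<Rightarrow> 'v set \<Rightarrow> bool" where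
  "fin_gen s V \<longleftrightarrow> (\<exists>S. finite S \<and> S \<subseteq> V \<and> module.span s S = V)"

definition free_mod :: "nat \<Rightarrow> (nat \<Rightarrow> 'a::comm_ring_1) set" where
  "free_mod n = {f. \<forall>k\<ge>n. f k = 0}"

text \<open>Finitely generated projective: a direct summand of some R^n (i split by p).\<close>
definition fg_projective :: "('a::comm_ring_1 \<Rightarrow> 'v::ab_group_add \<Rightarrow> 'v) \<Rightarrow> 'v set \<Rightarrow> bool" where
  "fg_projective s V \<longleftrightarrow> fin_gen s V \<and>
    (\<exists>n::nat. \<exists>i :: 'v \<Rightarrow> (nat \<Rightarrow> 'a). \<exists>p :: (nat \<Rightarrow> 'a) \<Rightarrow> 'v.
       (\<forall>x\<in>V. i x \<in> free_mod n) \<and>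
       (\<forall>x\<in>V. \<forall>y\<in>V. i (x + y) = (\<lambda>k. i x k + i y k)) \<and>
       (\<forall>a. \<forall>x\<in>V. i (s a x) = (\<lambda>k. a * i x k)) \<and>
       (\<forall>f\<in>free_mod n. p f \<in> V) \<and>
       (\<forall>f\<in>free_mod n. \<forall>g\<in>free_mod n. p (\<lambda>k. f k + g k) = p f + p g) \<and>
       (\<forall>a. \<forall>f\<in>free_mod n. p (\<lambda>k. a * f k) = s a (p f)) \<and>
       (\<forall>x\<in>V. p (i x) = x))"

definition polar :: "('v::ab_group_add \<Rightarrow> 'a::comm_ring_1) \<Rightarrow> 'v \<Rightarrow> 'v \<Rightarrow> 'a" where
  "polar q x y = q (x + y) - q x - q y"

definition quad_form :: "('a::comm_ring_1 \<Rightarrow> 'v::ab_group_add \<Rightarrow> 'v) \<Rightarrow> 'v set \<Rightarrow> ('v \<Rightarrow> 'a) \<Rightarrow> bool" where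
  "quad_form s V q \<longleftrightarrow> (\<forall>a. \<forall>x\<in>V. q (s a x) = a * a * q x) \<and>
     (\<forall>x\<in>V. \<forall>y\<in>V. \<forall>z\<in>V. polar q (x + y) z = polar q x z + polar q y z) \<and>
     (\<forall>a. \<forall>x\<in>V. \<forall>y\<in>V. polar q (s a x) y = a * polar q x y) \<and>
     (\<forall>x\<in>V. \<forall>y\<in>V. \<forall>z\<in>V. polar q x (y + z) = polar q x y + polar q x z) \<and>
     (\<forall>a. \<forall>x\<in>V. \<forall>y\<in>V. polar q x (s a y) = a * polar q x y)"

definition dual :: "('a::comm_ring_1 \<Rightarrow> 'v::ab_group_add \<Rightarrow> 'v) \<Rightarrow> 'v set \<Rightarrow> ('v \<Rightarrow> 'a) set" where
  "dual s V = {\<phi>. \<phi> \<in> extensional V \<and> lin_on s (*) V \<phi>}"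

definition non_singular :: "('a::comm_ring_1 \<Rightarrow> 'v::ab_group_add \<Rightarrow> 'v) \<Rightarrow> 'v set \<Rightarrow> ('v \<Rightarrow> 'a) \<Rightarrow> bool" where
  "non_singular s V q \<longleftrightarrow> bij_betw (\<lambda>x. restrict (\<lambda>y. polar q x y) V) V (dual s V)"

definition quad_module :: "('a::comm_ring_1 \<Rightarrow> 'v::ab_group_add \<Rightarrow> 'v) \<Rightarrow> 'v set \<Rightarrow> ('v \<Rightarrow> 'a) \<Rightarrow> bool" where
  "quad_module s V q \<longleftrightarrow> module.subspace s V \<and> fg_projective s V \<and> quad_form s V q \<and> non_singular s V q"

text \<open>Morphisms of Quad(R) (maps are only relevant on the carrier).\<close>
definition quad_hom :: "('a::comm_ring_1 \<Rightarrow> 'v::ab_group_add \<Rightarrow> 'v) \<Rightarrow> 'v set \<Rightarrow> ('v \<Rightarrow> 'a)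
    \<Rightarrow> ('a \<Rightarrow> 'w::ab_group_add \<Rightarrow> 'w) \<Rightarrow> 'w set \<Rightarrow> ('w \<Rightarrow> 'a) \<Rightarrow> ('v \<Rightarrow> 'w) \<Rightarrow> bool" where
  "quad_hom s V q t W r f \<longleftrightarrow> (\<forall>x\<in>V. f x \<in> W) \<and> lin_on s t V f \<and> (\<forall>x\<in>V. r (f x) = q x)"

definition quad_aut :: "('a::comm_ring_1 \<Rightarrow> 'v::ab_group_add \<Rightarrow> 'v) \<Rightarrow> 'v set \<Rightarrow> ('v \<Rightarrow> 'a) \<Rightarrow> ('v \<Rightarrow> 'v) \<Rightarrow> bool" where
  "quad_aut s V q f \<longleftrightarrow> quad_hom s V q s V q f \<and>
     (\<exists>g. quad_hom s V q s V q g \<and> (\<forall>x\<in>V. g (f x) = x \<and> f (g x) = x))"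

definition prod_scale :: "('a \<Rightarrow> 'v \<Rightarrow> 'v) \<Rightarrow> ('a \<Rightarrow> 'w \<Rightarrow> 'w) \<Rightarrow> 'a \<Rightarrow> 'v \<times> 'w \<Rightarrow> 'v \<times> 'w" where
  "prod_scale s t a p = (s a (fst p), t a (snd p))"

definition orth_sum :: "('v \<Rightarrow> 'a::comm_ring_1) \<Rightarrow> ('w \<Rightarrow> 'a) \<Rightarrow> 'v \<times> 'w \<Rightarrow> 'a" where
  "orth_sum q r p = q (fst p) + r (snd p)"

definition orth_sum_map :: "('v \<Rightarrow> 'v') \<Rightarrow> ('w \<Rightarrow> 'w') \<Rightarrow> 'v \<times> 'w \<Rightarrow> 'v' \<times> 'w'" where
  "orth_sum_map f g p = (f (fst p), g (snd p))"

end

theory Submission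
  imports Defs
begin

text \<open>
  (H1) is a Witt extension theorem. Let f, g be isometries X \<rightarrow> Y. One peels off a vector x of X whose
  norm is a unit on the support of X (cut out by an idempotent e), moves f x to g x by an
  automorphism of Y, and continues with the orthogonal complements of x and g x.

  To move u to v, where q u = q v, note that the reflection in z - v takes z to v when q (z - v) is
  a unit, which for z = u fails exactly at the maximal ideals where B(u,v) = 2 q(u), and for z = - u
  exactly where B(u,v) = - 2 q(u). A vector y congruent to u off the second set, and to an anisotropic
  vector orthogonal to u on it, has a reflection taking u to some z congruent to - u, respectively
  u, and the reflection in z - v finishes. Such a y exists unless the orthogonal complement of u
  vanishes at some of the maximal ideals of the second set; but the support of this complement is
  again cut out by an idempotent, and off this support u and v differ by a scalar of square 1, which
  is corrected beforehand.

  (H2) holds because Y is nondegenerate, so that an isometry fixing Y preserves its complement X.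
\<close>

section \<open>Ideals of a commutative ring\<close>

lemma ring_ideal_zero: "ring_ideal I \<Longrightarrow> 0 \<in> I"
  and ring_ideal_add: "ring_ideal I \<Longrightarrow> x \<in> I \<Longrightarrow> y \<in> I \<Longrightarrow> x + y \<in> I"
  and ring_ideal_mult: "ring_ideal I \<Longrightarrow> x \<in> I \<Longrightarrow> r * x \<in> I"
  by (auto simp: ring_ideal_def)

lemma ring_ideal_mult': "ring_ideal I \<Longrightarrow> x \<in> I \<Longrightarrow> x * r \<in> I"
  using ring_ideal_mult[of I x r] by (simp add: mult.commute)

lemma ring_ideal_minus: "ring_ideal I \<Longrightarrow> x \<in> I \<Longrightarrow> - x \<in> I"
  using ring_ideal_mult[of I x "-1"] by simp

lemma ring_ideal_diff: "ring_ideal I \<Longrightarrow> x \<in> I \<Longrightarrow> y \<in> I \<Longrightarrow> x - y \<in> I"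
  using ring_ideal_add[of I x "- y"] ring_ideal_minus[of I y] by simp

lemma ring_ideal_sum_list:
  "ring_ideal I \<Longrightarrow> (\<And>x. x \<in> set xs \<Longrightarrow> f x \<in> I) \<Longrightarrow> (\<Sum>x\<leftarrow>xs. f x) \<in> I"
  by (induction xs) (auto intro: ring_ideal_zero ring_ideal_add)

lemma ring_ideal_one: "ring_ideal I \<Longrightarrow> 1 \<in> I \<Longrightarrow> I = UNIV"
  using ring_ideal_mult[of I 1] by auto

lemma ring_ideal_plus_principal:
  fixes x :: "'a::comm_ring_1"
  assumes "ring_ideal I"
  shows "ring_ideal {a + r * x | a r. a \<in> I}"
  unfolding ring_ideal_def
proof (intro conjI ballI allI)
  show "0 \<in> {a + r * x | a r. a \<in> I}"
    using ring_ideal_zero[OF assms] by (intro CollectI exI[of _ 0]) auto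
next
  fix u v assume "u \<in> {a + r * x | a r. a \<in> I}" "v \<in> {a + r * x | a r. a \<in> I}"
  then obtain a r b t where "u = a + r * x" "v = b + t * x" "a \<in> I" "b \<in> I" by auto
  then show "u + v \<in> {a + r * x | a r. a \<in> I}"
    using ring_ideal_add[OF assms]
    by (intro CollectI exI[of _ "a + b"] exI[of _ "r + t"]) (auto simp: algebra_simps)
next
  fix c u assume "u \<in> {a + r * x | a r. a \<in> I}"
  then obtain a r where "u = a + r * x" "a \<in> I" by auto
  then show "c * u \<in> {a + r * x | a r. a \<in> I}"
    using ring_ideal_mult[OF assms]
    by (intro CollectI exI[of _ "c * a"] exI[of _ "c * r"]) (auto simp: algebra_simps)
qed

section \<open>Maximal ideals: existence, primality and separation\<close>

lemma maximal_ideal_exists: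
  assumes "ring_ideal (I :: 'a::comm_ring_1 set)" "1 \<notin> I"
  shows "\<exists>m. maximal_ideal m \<and> I \<subseteq> m"
proof -
  let ?A = "{J. ring_ideal J \<and> 1 \<notin> J \<and> I \<subseteq> J}"
  have "\<exists>M\<in>?A. \<forall>X\<in>?A. M \<subseteq> X \<longrightarrow> X = M"
  proof (rule subset_Zorn_nonempty)
    show "?A \<noteq> {}" using assms by auto
  next
    fix C assume C: "C \<noteq> {}" "subset.chain ?A C"
    then have idl: "\<And>J. J \<in> C \<Longrightarrow> ring_ideal J \<and> 1 \<notin> J \<and> I \<subseteq> J"
      and tot: "\<And>J K. J \<in> C \<Longrightarrow> K \<in> C \<Longrightarrow> J \<subseteq> K \<or> K \<subseteq> J"
      by (auto simp: subset.chain_def)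
    have "x + y \<in> \<Union>C" if "x \<in> \<Union>C" "y \<in> \<Union>C" for x y
    proof -
      obtain J K where "J \<in> C" "x \<in> J" "K \<in> C" "y \<in> K" using \<open>x \<in> \<Union>C\<close> \<open>y \<in> \<Union>C\<close> by blast
      then show ?thesis using tot[of J K] idl ring_ideal_add by blast
    qed
    moreover have "0 \<in> \<Union>C" using C idl ring_ideal_zero by blast
    moreover have "r * x \<in> \<Union>C" if "x \<in> \<Union>C" for r x
      using that idl ring_ideal_mult by blast
    ultimately have "ring_ideal (\<Union>C)"
      unfolding ring_ideal_def by simp
    moreover have "1 \<notin> \<Union>C" using idl by auto
    moreover have "I \<subseteq> \<Union>C" using C(1) idl by blast
    ultimately show "\<Union>C \<in> ?A" by simp
  qed
  then obtain M where M: "M \<in> ?A" and max: "\<forall>X\<in>?A. M \<subseteq> X \<longrightarrow> X = M" by (rule bexE)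
  have "J = M \<or> J = UNIV" if "ring_ideal J" "M \<subseteq> J" for J
    using that M bspec[OF max, of J] ring_ideal_one[of J] by auto
  then have "maximal_ideal M"
    using M unfolding maximal_ideal_def by blast
  then show ?thesis using M by blast
qed

lemma maximal_ideal_ideal: "maximal_ideal m \<Longrightarrow> ring_ideal m"
  by (simp add: maximal_ideal_def)

lemma maximal_ideal_one: "maximal_ideal m \<Longrightarrow> 1 \<notin> m"
  using ring_ideal_one by (auto simp: maximal_ideal_def)

lemma maximal_ideal_prime:
  fixes m :: "'a::comm_ring_1 set"
  assumes m: "maximal_ideal m" and xy: "x * y \<in> m"
  shows "x \<in> m \<or> y \<in> m"
proof (rule ccontr)
  assume "\<not> ?thesis"
  then have "x \<notin> m" "y \<notin> m" by auto
  let ?J = "{a + r * x | a r. a \<in> m}"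
  have idl: "ring_ideal m" using m by (rule maximal_ideal_ideal)
  have "m \<subseteq> ?J"
  proof
    fix z assume "z \<in> m"
    moreover have "z = z + 0 * x" by simp
    ultimately show "z \<in> ?J" by blast
  qed
  moreover have "x \<in> ?J"
    using ring_ideal_zero[OF idl] by (intro CollectI exI[of _ 0] exI[of _ 1]) auto
  ultimately have "?J = UNIV"
    using m ring_ideal_plus_principal[OF idl, of x] \<open>x \<notin> m\<close> unfolding maximal_ideal_def by blast
  then have "1 \<in> ?J" by blast
  then obtain a r where a: "1 = a + r * x" "a \<in> m" by auto
  have "y = (a + r * x) * y" using a(1) by simp
  also have "\<dots> = y * a + r * (x * y)" by (simp add: algebra_simps)
  also have "\<dots> \<in> m" by (intro ring_ideal_add[OF idl] ring_ideal_mult[OF idl a(2)] ring_ideal_mult[OF idl xy])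
  finally show False using \<open>y \<notin> m\<close> by blast
qed

lemma maximal_ideal_mult_iff:
  "maximal_ideal m \<Longrightarrow> x * y \<in> m \<longleftrightarrow> x \<in> m \<or> y \<in> m"
  using maximal_ideal_prime[of m x y] ring_ideal_mult[of m y x] ring_ideal_mult'[of m x y]
  by (auto dest: maximal_ideal_ideal)

lemma maximal_ideal_two:
  fixes h :: "'a::comm_ring_1" and m :: "'a set"
  assumes "maximal_ideal m" "2 * h = 1"
  shows "2 \<notin> m"
  using assms maximal_ideal_one[of m] ring_ideal_mult'[of m 2 h] maximal_ideal_ideal[of m] by auto

text \<open>The maximal ideals without \<open>e\<close> correspond to those of the factor ring
  \<open>e R\<close>, so \<open>a\<close> becomes a unit there. Concretely, \<open>1 - e\<close> and
  \<open>a\<close> generate the unit ideal, and multiplying \<open>1 = b * (1 - e) + r * a\<close>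
  by \<open>e\<close> removes the first term.\<close>

lemma unit_on_idempotent:
  fixes e a :: "'a::comm_ring_1"
  assumes e: "e * e = e" and a: "\<And>m. maximal_ideal m \<Longrightarrow> e \<notin> m \<Longrightarrow> a \<notin> m"
  shows "\<exists>d. d * a = e"
proof -
  \<comment> \<open>The ideal generated by \<open>1 - e\<close> and \<open>a\<close> is built from
    the zero ideal by adjoining one generator at a time, so that
    \<open>ring_ideal_plus_principal\<close> applies twice.\<close>
  define K where "K = {b + r * (1 - e) | b r. b \<in> {0}}"
  define J where "J = {b + r * a | b r. b \<in> K}"
  have idl: "ring_ideal J"
    unfolding J_def K_def by (intro ring_ideal_plus_principal) (auto simp: ring_ideal_def)
  have J: "x \<in> J \<longleftrightarrow> (\<exists>b r. x = b * (1 - e) + r * a)" for x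
    by (auto simp: J_def K_def)
  have "1 \<in> J"
  proof (rule ccontr)
    assume "1 \<notin> J"
    then obtain m where m: "maximal_ideal m" "J \<subseteq> m" using maximal_ideal_exists[OF idl] by blast
    have "1 - e \<in> J" unfolding J by (intro exI[of _ 1] exI[of _ 0]) simp
    moreover have "a \<in> J" unfolding J by (intro exI[of _ 0] exI[of _ 1]) simp
    ultimately have "1 - e \<in> m" "a \<in> m" using m by auto
    then have "e \<in> m" using a m by blast
    then have "1 \<in> m" using ring_ideal_add[OF maximal_ideal_ideal[OF m(1)] \<open>1 - e \<in> m\<close>, of e] by simp
    then show False using maximal_ideal_one m by blast
  qed
  then obtain b r where "1 = b * (1 - e) + r * a" by (auto simp: J)
  then have "e * 1 = e * (b * (1 - e) + r * a)" by simp
  also have "\<dots> = (e * r) * a" using e by (simp add: algebra_simps)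
  finally have "(e * r) * a = e" by simp
  then show ?thesis by blast
qed

text \<open>Distinct maximal ideals do not contain each other, so every \<open>n\<close> in
  \<open>M\<close> has an element outside \<open>m\<close>; since \<open>m\<close> is prime, the
  product of these elements stays outside \<open>m\<close>.\<close>

lemma maximal_ideal_separate:
  assumes "finite M" "maximal_ideal m" "\<And>n. n \<in> M \<Longrightarrow> maximal_ideal n" "m \<notin> M"
  shows "\<exists>r :: 'a::comm_ring_1. r \<notin> m \<and> (\<forall>n\<in>M. r \<in> n)"
  using assms(1,3,4)
proof (induction M)
  case empty
  then show ?case using maximal_ideal_one[OF assms(2)] by auto
next
  case (insert n M)
  then obtain r where r: "r \<notin> m" "\<forall>n\<in>M. r \<in> n" by auto
  have "\<not> n \<subseteq> m" using insert.prems assms(2) unfolding maximal_ideal_def by blast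
  then obtain t where t: "t \<in> n" "t \<notin> m" by auto
  have "t * r \<notin> m" using r t maximal_ideal_mult_iff[OF assms(2)] by auto
  moreover have "t * r \<in> k" if "k \<in> insert n M" for k
    using that r t insert.prems(1)[of k] by (auto intro: ring_ideal_mult ring_ideal_mult' maximal_ideal_ideal)
  ultimately show ?case by blast
qed

text \<open>This replaces the Chinese remainder theorem: coefficients will matter only through the
  maximal ideals in which they lie.\<close>

lemma maximal_ideals_separate:
  assumes fin: "finite M" "finite N" and max: "\<And>m. m \<in> M \<union> N \<Longrightarrow> maximal_ideal m"
    and disj: "M \<inter> N = {}"
  shows "\<exists>r :: 'a::comm_ring_1. (\<forall>m\<in>M. r \<notin> m) \<and> (\<forall>n\<in>N. r \<in> n)"
  using fin(1) max disj
proof (induction M)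
  case empty
  then show ?case using ring_ideal_zero maximal_ideal_ideal by blast
next
  case (insert m M)
  then obtain r where r: "\<forall>k\<in>M. r \<notin> k" "\<forall>n\<in>N. r \<in> n" by auto
  obtain t where t: "t \<notin> m" "\<forall>n\<in>M \<union> N. t \<in> n"
    using maximal_ideal_separate[of "M \<union> N" m] insert fin by blast
  have idl: "ring_ideal k" if "k \<in> insert m M \<union> N" for k
    using that insert.prems(1) maximal_ideal_ideal by blast
  \<comment> \<open>Adding \<open>t\<close> disturbs \<open>r\<close> at no ideal treated before,
    and \<open>r\<close> and \<open>r + t\<close> cannot both lie in \<open>m\<close>, as their
    difference does not.\<close>
  have "\<exists>x. x \<in> {r, r + t} \<and> x \<notin> m"
    using ring_ideal_diff[of m "r + t" r] idl[of m] t by auto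
  then obtain x where x: "x \<in> {r, r + t}" "x \<notin> m" by blast
  have "x \<notin> k" if "k \<in> M" for k
    using x(1) r(1) t(2) that ring_ideal_diff[of k "r + t" t] idl[of k] by auto
  moreover have "x \<in> n" if "n \<in> N" for n
    using x(1) r(2) t(2) that ring_ideal_add[of n r t] idl[of n] by auto
  ultimately show ?case using x(2) by blast
qed

section \<open>Quadratic spaces\<close>

text \<open>The element c is the induction variable: generators are eliminated from S one at a time.\<close>

lemma (in module) nakayama:
  assumes I: "ring_ideal I" and S: "finite S" "S \<subseteq> V"
    and V: "subspace V" "V \<subseteq> span {scale a y | a y. a \<in> I \<and> y \<in> V}"
    and c: "c \<in> I" "\<And>x. x \<in> V \<Longrightarrow> scale (1 - c) x \<in> span S"
  shows "\<exists>e\<in>I. \<forall>x\<in>V. scale e x = x"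
  using S c
proof (induction S arbitrary: c)
  case empty
  then have "scale c x = x" if "x \<in> V" for x
    using that by (auto simp: scale_left_diff_distrib)
  then show ?case using empty by blast
next
  case (insert t S)
  have t: "t \<in> V" using insert.prems by blast
  \<comment> \<open>Modulo \<open>span S\<close>, the map \<open>1 - c\<close> sends
    \<open>V\<close> to multiples of \<open>t\<close>; since \<open>V\<close> is contained in
    \<open>I V\<close>, the coefficient can be chosen in \<open>I\<close>.\<close>
  have *: "\<exists>b\<in>I. scale (1 - c) x - scale b t \<in> span S" if "x \<in> V" for x
  proof -
    from that have "x \<in> span {scale a y | a y. a \<in> I \<and> y \<in> V}" using V by blast
    then show ?thesis
    proof (induction rule: span_induct_alt)
      case base
      then show ?case using ring_ideal_zero[OF I] by (auto intro!: bexI[of _ 0] span_zero)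
    next
      case (step r w z)
      then obtain a y b where w: "w = scale a y" "a \<in> I" "y \<in> V"
        and b: "b \<in> I" "scale (1 - c) z - scale b t \<in> span S" by blast
      obtain k where k: "scale (1 - c) y - scale k t \<in> span S"
        using insert.prems(3)[OF w(3)] span_breakdown_eq by blast
      have "scale (1 - c) (scale r w + z) - scale (r * a * k + b) t =
        scale (r * a) (scale (1 - c) y - scale k t) + (scale (1 - c) z - scale b t)"
        by (simp add: w algebra_simps scale_right_diff_distrib scale_right_distrib
            scale_left_diff_distrib scale_left_distrib)
      also have "\<dots> \<in> span S" using b k by (intro span_add span_scale)
      finally show ?case using b w I by (auto intro!: bexI[of _ "r * a * k + b"] ring_ideal_add ring_ideal_mult' ring_ideal_mult[of I a r])
    qed
  qed
  obtain b where b: "b \<in> I" "scale (1 - c) t - scale b t \<in> span S" using *[OF t] by blast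
  \<comment> \<open>Modulo \<open>span S\<close>, \<open>1 - c\<close> maps \<open>V\<close> into
    the multiples of \<open>t\<close> and acts on \<open>t\<close> as \<open>b\<close>. So
    \<open>1 - c - b\<close> annihilates \<open>t\<close> there, and the product
    \<open>1 - c' = (1 - c - b) * (1 - c)\<close> annihilates \<open>V\<close>.\<close>
  define c' where "c' = 1 - (1 - c - b) * (1 - c)"
  have "c' = c + (1 - c) * (c + b)" by (simp add: c'_def algebra_simps)
  also have "\<dots> \<in> I" using b(1) insert.prems(2) by (intro ring_ideal_add[OF I] ring_ideal_mult[OF I])
  finally have "c' \<in> I" .
  moreover have "scale (1 - c') x \<in> span S" if "x \<in> V" for x
  proof -
    obtain k where k: "scale (1 - c) x - scale k t \<in> span S"
      using insert.prems(3)[OF \<open>x \<in> V\<close>] span_breakdown_eq by blast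
    have "1 - c' = (1 - c - b) * (1 - c)" by (simp add: c'_def)
    then have "scale (1 - c') x = scale (1 - c - b) (scale (1 - c) x)" by simp
    also have "\<dots> = scale (1 - c - b) (scale (1 - c) x - scale k t) +
        scale k (scale (1 - c) t - scale b t)"
      by (simp only: scale_right_diff_distrib scale_scale) (simp add: algebra_simps scale_left_diff_distrib)
    also have "\<dots> \<in> span S" using b k by (intro span_add span_scale)
    finally show ?thesis .
  qed
  ultimately show ?case using insert.IH[of c'] insert.prems(1) by blast
qed

lemma polar_commute: "polar q x y = polar q y x"
  by (simp add: polar_def add.commute)

text \<open>Unlike nonsingularity, these conditions pass to every submodule
  (\<open>subspace_quad_space\<close>), in particular to orthogonal complements.\<close>

locale quad_space = module s
  for s :: "'a::comm_ring_1 \<Rightarrow> 'v::ab_group_add \<Rightarrow> 'v" +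
  fixes V :: "'v set" and q :: "'v \<Rightarrow> 'a" and h :: 'a
  assumes sub: "subspace V" and quad: "quad_form s V q" and half: "2 * h = 1"
begin

abbreviation B :: "'v \<Rightarrow> 'v \<Rightarrow> 'a" where "B \<equiv> polar q"

lemma closed [simp]: "0 \<in> V" "x \<in> V \<Longrightarrow> y \<in> V \<Longrightarrow> x + y \<in> V" "x \<in> V \<Longrightarrow> y \<in> V \<Longrightarrow> x - y \<in> V"
  "x \<in> V \<Longrightarrow> - x \<in> V" "x \<in> V \<Longrightarrow> s a x \<in> V"
  using sub by (auto intro: subspace_0 subspace_add subspace_diff subspace_neg subspace_scale)

lemma half' [simp]: "h * (2 * x) = x" "2 * (h * x) = x"
  using half by (metis mult.assoc mult.commute mult.left_neutral)+

lemma q_scale [simp]: "x \<in> V \<Longrightarrow> q (s a x) = a * a * q x"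
  using quad by (auto simp: quad_form_def)

lemma B_bilin [simp]:
  assumes "x \<in> V" "y \<in> V"
  shows "z \<in> V \<Longrightarrow> B (x + y) z = B x z + B y z"
    "z \<in> V \<Longrightarrow> B x (y + z) = B x y + B x z"
    "B (s a x) y = a * B x y" "B x (s a y) = a * B x y"
  using quad assms by (auto simp: quad_form_def)

lemma B_zero [simp]: "x \<in> V \<Longrightarrow> B 0 x = 0" "x \<in> V \<Longrightarrow> B x 0 = 0"
  using B_bilin(3)[of 0 x 0] B_bilin(4)[of x 0 0] by auto

lemma B_diff [simp]:
  assumes "x \<in> V" "y \<in> V" "z \<in> V"
  shows "B (x - y) z = B x z - B y z" "B x (y - z) = B x y - B x z"
  using B_bilin(1)[of "x - y" y z] B_bilin(2)[of x "y - z" z] assms by auto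

lemma B_minus [simp]:
  assumes "x \<in> V" "y \<in> V"
  shows "B (- x) y = - B x y" "B x (- y) = - B x y"
  using B_diff(1)[of 0 x y] B_diff(2)[of x 0 y] assms by auto

lemma B_sum_list:
  assumes "\<And>x. x \<in> set xs \<Longrightarrow> f x \<in> V" "z \<in> V"
  shows "(\<Sum>x\<leftarrow>xs. f x) \<in> V" "B z (\<Sum>x\<leftarrow>xs. f x) = (\<Sum>x\<leftarrow>xs. B z (f x))"
  using assms by (induction xs) auto

lemma q_add: "q (x + y) = q x + q y + B x y"
  by (simp add: polar_def)

lemma B_self [simp]: "x \<in> V \<Longrightarrow> B x x = 2 * q x"
proof -
  assume "x \<in> V"
  have "x + x = s 2 x" using scale_left_distrib[of 1 1 x] by simp
  then have "q (x + x) = 4 * q x" using q_scale[OF \<open>x \<in> V\<close>, of 2] by simp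
  then show ?thesis by (simp add: polar_def)
qed

lemma q_minus [simp]: "x \<in> V \<Longrightarrow> q (- x) = q x"
  using q_scale[of x "-1"] by simp

lemma q_diff: "x \<in> V \<Longrightarrow> y \<in> V \<Longrightarrow> q (x - y) = q x + q y - B x y"
  using q_add[of x "- y"] by simp

section \<open>Vectors anisotropic modulo maximal ideals\<close>

lemma q_not_in:
  assumes m: "maximal_ideal m" and x: "x \<in> V" "y \<in> V" "B x y \<notin> m"
  shows "\<exists>z\<in>V. q z \<notin> m"
proof (rule ccontr)
  assume "\<not> ?thesis"
  then have "q (x + y) \<in> m" "q x \<in> m" "q y \<in> m" using x by auto
  then have "B x y \<in> m"
    unfolding polar_def using maximal_ideal_ideal[OF m] by (intro ring_ideal_diff)
  then show False using x by blast
qed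

lemma subspace_quad_space:
  assumes "subspace W" "W \<subseteq> V"
  shows "quad_space s W q h"
proof unfold_locales
  show "quad_form s W q" using quad assms(2) unfolding quad_form_def by (meson subsetD)
qed (use assms half in auto)

text \<open>Induction over the ideals. A vector \<open>w\<close> good on \<open>M\<close> is changed
  by a multiple \<open>r z\<close>, where \<open>z\<close> is anisotropic at \<open>m\<close> and
  the coefficient \<open>r\<close> lies in all ideals of \<open>M\<close> but not in
  \<open>m\<close>; so nothing changes modulo the ideals of \<open>M\<close>.\<close>

lemma unit_vector_aux:
  assumes "finite M" "\<And>m. m \<in> M \<Longrightarrow> maximal_ideal m \<and> (\<exists>x\<in>V. q x \<notin> m)"
  shows "\<exists>w\<in>V. \<forall>m\<in>M. q w \<notin> m"
  using assms
proof (induction M)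
  case empty
  then show ?case by (intro bexI[of _ 0]) auto
next
  case (insert m M)
  then obtain w where w: "w \<in> V" "\<forall>n\<in>M. q w \<notin> n" by auto
  obtain z where z: "z \<in> V" "q z \<notin> m" using insert.prems by blast
  have max: "maximal_ideal m" using insert.prems by blast
  then have idl: "ring_ideal m" by (rule maximal_ideal_ideal)
  obtain r where r: "r \<notin> m" "\<forall>n\<in>M. r \<in> n"
    using maximal_ideal_separate[OF insert.hyps(1) max] insert by blast
  \<comment> \<open>By the parallelogram identity the three values combine to
    \<open>2 * r * r * q z\<close>, whose factors all avoid \<open>m\<close>.\<close>
  have "\<exists>y\<in>{w, w + s r z, w - s r z}. q y \<notin> m"
  proof (rule ccontr)
    assume "\<not> ?thesis"
    then have "q (w + s r z) + q (w - s r z) - 2 * q w \<in> m"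
      by (intro ring_ideal_add[OF idl] ring_ideal_diff[OF idl] ring_ideal_mult[OF idl]) auto
    also have "q (w + s r z) + q (w - s r z) - 2 * q w = 2 * (r * (r * q z))"
      using w z by (simp add: q_add q_diff algebra_simps)
    finally show False
      using r z maximal_ideal_two[OF max half] by (simp add: maximal_ideal_mult_iff[OF max])
  qed
  then obtain y where y: "y \<in> {w, w + s r z, w - s r z}" "q y \<notin> m" by blast
  have "q y \<notin> n" if n: "n \<in> M" for n
  proof
    assume "q y \<in> n"
    have idl: "ring_ideal n" using insert.prems n maximal_ideal_ideal by blast
    have "r \<in> n" using r n by blast
    consider "y = w" | "y = w + s r z" | "y = w - s r z" using y(1) by blast
    then have "\<exists>c. q y = q w + c * r"
    proof cases
      case 1
      then show ?thesis by (intro exI[of _ 0]) simp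
    next
      case 2
      show ?thesis unfolding 2 using w z by (intro exI[of _ "r * q z + B w z"]) (simp add: q_add algebra_simps)
    next
      case 3
      show ?thesis unfolding 3 using w z by (intro exI[of _ "r * q z - B w z"]) (simp add: q_diff algebra_simps)
    qed
    then obtain c where "q y = q w + c * r" by blast
    then have "q w = q y - c * r" by simp
    then have "q w \<in> n" using ring_ideal_diff[OF idl \<open>q y \<in> n\<close> ring_ideal_mult[OF idl \<open>r \<in> n\<close>]] by simp
    then show False using w n by blast
  qed
  then show ?case using y w z by (intro bexI[of _ y]) auto
qed

lemma unit_vector:
  assumes "semi_local TYPE('a)"
  shows "\<exists>w\<in>V. \<forall>m. maximal_ideal m \<longrightarrow> (\<exists>x\<in>V. q x \<notin> m) \<longrightarrow> q w \<notin> m"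
proof -
  let ?M = "{m. maximal_ideal m \<and> (\<exists>x\<in>V. q x \<notin> m)}"
  have "finite ?M"
    using assms unfolding semi_local_def by (rule finite_subset[rotated]) auto
  moreover have "maximal_ideal m \<and> (\<exists>x\<in>V. q x \<notin> m)" if "m \<in> ?M" for m
    using that by (rule CollectD)
  ultimately have "\<exists>w\<in>V. \<forall>m\<in>?M. q w \<notin> m" by (rule unit_vector_aux)
  then show ?thesis by (elim bexE) (rule bexI, auto)
qed

end

text \<open>A frame is a dual basis of V whose functionals are represented by vectors of V. Its existence
  expresses at once that V is finitely generated projective and that q is non-singular.\<close>

definition frame :: "('a::comm_ring_1 \<Rightarrow> 'v::ab_group_add \<Rightarrow> 'v) \<Rightarrow> 'v set \<Rightarrow> ('v \<Rightarrow> 'a) \<Rightarrow> ('v \<times> 'v) list \<Rightarrow> bool" where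
  "frame s V q L \<longleftrightarrow> set L \<subseteq> V \<times> V \<and> (\<forall>x\<in>V. x = (\<Sum>p\<leftarrow>L. s (polar q (fst p) x) (snd p)))"

locale nonsing_space = quad_space +
  assumes frame: "\<exists>L. frame s V q L"
begin

lemma B_nondegenerate:
  assumes "x \<in> V" "\<And>y. y \<in> V \<Longrightarrow> B x y = 0"
  shows "x = 0"
proof -
  obtain L where L: "set L \<subseteq> V \<times> V" "x = (\<Sum>p\<leftarrow>L. s (B (fst p) x) (snd p))"
    using frame assms(1) unfolding frame_def by blast
  have "(\<Sum>p\<leftarrow>L. s (B (fst p) x) (snd p)) = (\<Sum>p\<leftarrow>L. 0)"
    using L(1) assms(2) by (intro arg_cong[of _ _ sum_list] map_cong) (auto simp: polar_commute[of q _ x])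
  then show ?thesis using L(2) by simp
qed

text \<open>Let \<open>I\<close> be the ideal generated by the values of \<open>B\<close>. A frame
  shows \<open>V = I V\<close>, so Nakayama yields \<open>e\<close> in \<open>I\<close> acting as
  the identity on \<open>V\<close>. Then \<open>e\<close> fixes all values of \<open>B\<close>,
  hence all of \<open>I\<close>, in particular itself. A maximal ideal containing all values of
  \<open>q\<close> contains \<open>I\<close>, and so \<open>e\<close>.\<close>

lemma support_idempotent:
  obtains e where "e * e = e" "\<And>x. x \<in> V \<Longrightarrow> s e x = x"
    "\<And>m. maximal_ideal m \<Longrightarrow> e \<notin> m \<Longrightarrow> \<exists>x\<in>V. q x \<notin> m"
proof -
  obtain L where L: "set L \<subseteq> V \<times> V" "\<And>x. x \<in> V \<Longrightarrow> x = (\<Sum>p\<leftarrow>L. s (B (fst p) x) (snd p))"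
    using frame unfolding frame_def by blast
  define I where "I = {a. \<forall>J. ring_ideal J \<longrightarrow> (\<forall>x\<in>V. \<forall>y\<in>V. B x y \<in> J) \<longrightarrow> a \<in> J}"
  have I: "ring_ideal I"
    unfolding I_def
    by (subst ring_ideal_def) (auto intro: ring_ideal_zero ring_ideal_add ring_ideal_mult)
  have in_span: "x \<in> span T" if "x \<in> V" "\<And>p. p \<in> set L \<Longrightarrow> s (B (fst p) x) (snd p) \<in> span T" for x T
  proof -
    have "(\<Sum>p\<leftarrow>K. s (B (fst p) x) (snd p)) \<in> span T" if "set K \<subseteq> set L" for K
      using that \<open>\<And>p. p \<in> set L \<Longrightarrow> s (B (fst p) x) (snd p) \<in> span T\<close>
      by (induction K) (auto intro: span_zero span_add)
    then show ?thesis using L(2)[OF that(1)] order_refl by metis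
  qed
  have "\<exists>e\<in>I. \<forall>x\<in>V. s e x = x"
  proof (rule nakayama[OF I _ _ sub])
    show "finite (snd ` set L)" "snd ` set L \<subseteq> V" using L(1) by auto
    show "V \<subseteq> span {s a y |a y. a \<in> I \<and> y \<in> V}"
    proof
      fix x assume "x \<in> V"
      then show "x \<in> span {s a y |a y. a \<in> I \<and> y \<in> V}"
      proof (rule in_span)
        fix p assume "p \<in> set L"
        then have "fst p \<in> V" "snd p \<in> V" using L(1) by auto
        moreover have "B (fst p) x \<in> I" using \<open>fst p \<in> V\<close> \<open>x \<in> V\<close> by (auto simp: I_def)
        ultimately show "s (B (fst p) x) (snd p) \<in> span {s a y |a y. a \<in> I \<and> y \<in> V}"
          by (intro span_base) blast
      qed
    qed
    show "0 \<in> I" using I by (rule ring_ideal_zero)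
    show "s (1 - 0) x \<in> span (snd ` set L)" if "x \<in> V" for x
      using in_span[OF that, of "snd ` set L"] by (auto intro: span_scale span_base)
  qed
  then obtain e where e: "e \<in> I" "\<And>x. x \<in> V \<Longrightarrow> s e x = x" by blast
  have "B x y - e * B x y = 0" if "x \<in> V" "y \<in> V" for x y
    using B_bilin(3)[of x y e] e that by simp
  \<comment> \<open>The annihilator of \<open>1 - e\<close> is an ideal containing all values of
    \<open>B\<close>, so it contains \<open>I\<close> and thereby \<open>e\<close>.\<close>
  moreover have "ring_ideal {a. a - e * a = 0}"
    unfolding ring_ideal_def by (auto simp: algebra_simps)
  ultimately have "e \<in> {a. a - e * a = 0}" using e(1) unfolding I_def by blast
  then have "e * e = e" by simp
  moreover have "\<exists>x\<in>V. q x \<notin> m" if m: "maximal_ideal m" "e \<notin> m" for m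
  proof (rule ccontr)
    assume "\<not> ?thesis"
    then have "\<forall>x\<in>V. \<forall>y\<in>V. B x y \<in> m" using q_not_in[OF m(1)] by blast
    then have "e \<in> m" using e(1) maximal_ideal_ideal[OF m(1)] unfolding I_def by blast
    then show False using m by blast
  qed
  ultimately show thesis using that e by blast
qed

end

section \<open>Isometries\<close>

lemma quad_hom_comp:
  assumes "quad_hom s V q t W r f" "quad_hom t W r t' W' r' g"
  shows "quad_hom s V q t' W' r' (\<lambda>x. g (f x))"
  using assms unfolding quad_hom_def lin_on_def by simp

lemma quad_hom_polar:
  assumes "quad_hom s V q t W r f" "x \<in> V" "y \<in> V" "x + y \<in> V"
  shows "polar r (f x) (f y) = polar q x y"
  using assms unfolding quad_hom_def lin_on_def polar_def by metis

lemma quad_aut_comp: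
  assumes "quad_aut s V q f" "quad_aut s V q g"
  shows "quad_aut s V q (\<lambda>x. g (f x))"
proof -
  obtain f' where f: "quad_hom s V q s V q f" "quad_hom s V q s V q f'"
      "\<forall>x\<in>V. f' (f x) = x \<and> f (f' x) = x"
    using assms unfolding quad_aut_def by blast
  obtain g' where g: "quad_hom s V q s V q g" "quad_hom s V q s V q g'"
      "\<forall>x\<in>V. g' (g x) = x \<and> g (g' x) = x"
    using assms unfolding quad_aut_def by blast
  have "\<forall>x\<in>V. f x \<in> V \<and> g' x \<in> V" using f g unfolding quad_hom_def by blast
  then have "\<forall>x\<in>V. f' (g' (g (f x))) = x \<and> g (f (f' (g' x))) = x" using f(3) g(3) by simp
  then show ?thesis unfolding quad_aut_def
    using quad_hom_comp[OF f(1) g(1)] quad_hom_comp[OF g(2) f(2)] by blast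
qed

lemma quad_aut_id: "quad_aut s V q (\<lambda>x. x)"
  unfolding quad_aut_def quad_hom_def lin_on_def by auto

lemma quad_aut_hom: "quad_aut s V q f \<Longrightarrow> quad_hom s V q s V q f"
  by (simp add: quad_aut_def)

lemma quad_aut_involution:
  "quad_hom s V q s V q f \<Longrightarrow> (\<And>x. x \<in> V \<Longrightarrow> f (f x) = x) \<Longrightarrow> quad_aut s V q f"
  unfolding quad_aut_def by blast

section \<open>Reflections, scalars and orthogonal complements\<close>

context quad_space
begin

text \<open>The usual reflection subtracts \<open>B x z / q z\<close> times \<open>z\<close>. Here
  \<open>d\<close> stands for the inverse of \<open>q z\<close>, which need only exist on the
  support of \<open>z\<close>: the condition \<open>s (d * q z) z = z\<close> takes the place of
  \<open>d * q z = 1\<close>.\<close>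

definition reflect :: "'a \<Rightarrow> 'v \<Rightarrow> 'v \<Rightarrow> 'v" where
  "reflect d z x = x - s (d * B x z) z"

lemma reflect_aut:
  assumes z: "z \<in> V" "s (d * q z) z = z"
  shows "quad_aut s V q (reflect d z)"
proof (rule quad_aut_involution)
  \<comment> \<open>Since \<open>d * q z\<close> fixes \<open>z\<close>, it fixes every value
    \<open>B x z\<close>; this is the only cancellation needed.\<close>
  have B: "d * (q z * B x z) = B x z" if "x \<in> V" for x
    using B_bilin(4)[of x z "d * q z"] that z by (simp add: mult.assoc)
  show "quad_hom s V q s V q (reflect d z)"
    unfolding quad_hom_def lin_on_def
  proof (intro conjI ballI allI)
    fix x assume x: "x \<in> V"
    show "reflect d z x \<in> V" using x z by (simp add: reflect_def)
    have "q (reflect d z x) = q x + d * B x z * (d * (q z * B x z)) - d * B x z * B x z"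
      using x z by (simp add: reflect_def q_diff algebra_simps)
    then show "q (reflect d z x) = q x" by (simp add: B[OF x])
  qed (use z in \<open>simp_all add: reflect_def algebra_simps scale_left_distrib scale_right_diff_distrib\<close>)
  fix x assume x: "x \<in> V"
  have "B (reflect d z x) z = B x z - 2 * (d * (q z * B x z))"
    using x z by (simp add: reflect_def algebra_simps)
  also have "\<dots> = - B x z" unfolding B[OF x] by simp
  finally show "reflect d z (reflect d z x) = x" by (simp add: reflect_def[of d z "reflect d z x"]) (simp add: reflect_def)
qed

lemma scalar_aut:
  assumes "\<mu> * \<mu> = 1"
  shows "quad_aut s V q (s \<mu>)"
proof (rule quad_aut_involution)
  show "quad_hom s V q s V q (s \<mu>)"
    unfolding quad_hom_def lin_on_def using assms
    by (auto simp: scale_right_distrib mult.commute)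
qed (simp add: assms)

definition ortho :: "'v \<Rightarrow> 'v set" where
  "ortho u = {x \<in> V. B u x = 0}"

text \<open>Orthogonal projection along \<open>u\<close>: the coefficient
  \<open>B u x / B u u\<close> becomes \<open>h * (d * B u x)\<close>, because
  \<open>B u u = 2 * q u\<close>.\<close>

definition proj :: "'a \<Rightarrow> 'v \<Rightarrow> 'v \<Rightarrow> 'v" where
  "proj d u x = x - s (h * (d * B u x)) u"

lemma ortho_quad_space:
  assumes "u \<in> V"
  shows "quad_space s (ortho u) q h"
  using assms by (intro subspace_quad_space) (auto simp: ortho_def subspace_def)

lemma proj_in_ortho:
  assumes "u \<in> V" "s (d * q u) u = u" "x \<in> V"
  shows "proj d u x \<in> ortho u"
  using assms B_bilin(3)[of u x "d * q u"]
  by (simp add: proj_def ortho_def algebra_simps)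

lemma proj_add_scale: "proj d u x + s (h * (d * B u x)) u = x"
  by (simp add: proj_def)

lemma proj_lin:
  assumes "u \<in> V" "x \<in> V"
  shows "y \<in> V \<Longrightarrow> proj d u (x + y) = proj d u x + proj d u y"
    "proj d u (s a x) = s a (proj d u x)"
  using assms by (simp_all add: proj_def algebra_simps scale_left_distrib scale_right_diff_distrib)

lemma proj_ortho [simp]: "x \<in> ortho u \<Longrightarrow> proj d u x = x"
  by (simp add: proj_def ortho_def)

lemma proj_self [simp]:
  assumes "u \<in> V" "s (d * q u) u = u"
  shows "proj d u u = 0"
  using assms by (simp add: proj_def mult.left_commute[of d 2])

text \<open>\<open>V\<close> is the orthogonal sum of \<open>ortho u\<close> and the multiples of
  \<open>u\<close>; \<open>F\<close> is \<open>f\<close> on the first and the identity on the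
  second. The last two claims describe the components of \<open>F x\<close>, from which
  \<open>extend_aut\<close> reads off that the extension of an inverse is inverse.\<close>

lemma extend_hom:
  assumes u: "u \<in> V" "s (d * q u) u = u"
    and f: "quad_hom s (ortho u) q s (ortho u) q f"
  defines "F \<equiv> (\<lambda>x. f (proj d u x) + s (h * (d * B u x)) u)"
  shows "quad_hom s V q s V q F"
    "x \<in> V \<Longrightarrow> proj d u (F x) = f (proj d u x)"
    "x \<in> V \<Longrightarrow> B u (F x) = B u x"
proof -
  have fp: "f (proj d u x) \<in> V" "B u (f (proj d u x)) = 0" if "x \<in> V" for x
    using f proj_in_ortho[OF u that] unfolding quad_hom_def ortho_def by auto
  show B: "B u (F x) = B u x" if "x \<in> V" for x
    using fp[OF that] u that B_bilin(3)[of u x "d * q u"] by (simp add: F_def algebra_simps)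
  show "proj d u (F x) = f (proj d u x)" if "x \<in> V" for x
    using B[OF that] by (simp add: proj_def) (simp add: F_def proj_def)
  have qsum: "q (y + s a u) = q y + a * a * q u" if "y \<in> V" "B u y = 0" for y a
    using that u by (simp add: q_add polar_commute[of q y])
  show "quad_hom s V q s V q F"
    unfolding quad_hom_def lin_on_def
  proof (intro conjI ballI allI)
    fix x assume x: "x \<in> V"
    show "F x \<in> V" using fp[OF x] u by (simp add: F_def)
    note o = proj_in_ortho[OF u x]
    have "q (F x) = q (proj d u x + s (h * (d * B u x)) u)"
      using fp[OF x] o f unfolding F_def quad_hom_def by (simp add: qsum ortho_def)
    then show "q (F x) = q x" by (simp add: proj_add_scale)
    show "F (s a x) = s a (F x)" for a
      using f o u x unfolding F_def quad_hom_def lin_on_def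
      by (simp add: proj_lin scale_right_distrib algebra_simps)
    fix y assume y: "y \<in> V"
    show "F (x + y) = F x + F y"
      using f o proj_in_ortho[OF u y] u x y unfolding F_def quad_hom_def lin_on_def
      by (simp add: proj_lin scale_left_distrib algebra_simps)
  qed
qed

lemma extend_aut:
  assumes u: "u \<in> V" "s (d * q u) u = u"
    and f: "quad_aut s (ortho u) q f"
  shows "\<exists>F. quad_aut s V q F \<and> F u = u \<and> (\<forall>x\<in>ortho u. F x = f x)"
proof -
  obtain g where f: "quad_hom s (ortho u) q s (ortho u) q f" "quad_hom s (ortho u) q s (ortho u) q g"
      "\<forall>x\<in>ortho u. g (f x) = x \<and> f (g x) = x"
    using f unfolding quad_aut_def by blast
  define F where "F = (\<lambda>f x. f (proj d u x) + s (h * (d * B u x)) u)"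
  have F: "F k x = k (proj d u x) + s (h * (d * B u x)) u" for k x by (simp add: F_def)
  note ext = extend_hom[OF u]
  have hom: "quad_hom s V q s V q (F k)" if "quad_hom s (ortho u) q s (ortho u) q k" for k
    using ext(1)[OF that] by (simp add: F_def)
  have gf: "F g (F f x) = x" "F f (F g x) = x" if "x \<in> V" for x
    using f(3) ext(2,3)[OF f(1) that] ext(2,3)[OF f(2) that] proj_in_ortho[OF u that]
    by (simp_all add: F[of g] F[of f] proj_add_scale)
  have "0 \<in> ortho u" using u by (simp add: ortho_def)
  then have "f (0 + 0) = f 0 + f 0" using f(1) unfolding quad_hom_def lin_on_def by blast
  then have zero: "f 0 = 0" by simp
  have "quad_aut s V q (F f)"
    unfolding quad_aut_def using gf hom[OF f(1)] hom[OF f(2)] by blast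
  moreover have "F f u = u"
    using u zero by (simp add: F mult.left_commute[of d 2])
  moreover have "\<forall>x\<in>ortho u. F f x = f x"
    by (simp add: F) (simp add: ortho_def)
  ultimately show ?thesis by blast
qed

end

text \<open>A frame of \<open>V\<close> projects to one of \<open>ortho u\<close>: the projection is
  linear and fixes \<open>ortho u\<close>, and pairing with an \<open>x\<close> orthogonal to
  \<open>u\<close> does not notice it.\<close>

lemma (in nonsing_space) ortho_nonsing_space:
  assumes u: "u \<in> V" "s (d * q u) u = u"
  shows "nonsing_space s (ortho u) q h"
proof -
  interpret U: quad_space s "ortho u" q h using u by (intro ortho_quad_space)
  obtain L where L: "set L \<subseteq> V \<times> V" "\<And>x. x \<in> V \<Longrightarrow> x = (\<Sum>p\<leftarrow>L. s (B (fst p) x) (snd p))"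
    using frame unfolding frame_def by blast
  define L' where "L' = map (\<lambda>p. (proj d u (fst p), proj d u (snd p))) L"
  have "frame s (ortho u) q L'"
    unfolding frame_def
  proof (intro conjI ballI)
    show "set L' \<subseteq> ortho u \<times> ortho u"
      using L(1) proj_in_ortho[OF u] by (auto simp: L'_def)
    fix x assume x: "x \<in> ortho u"
    then have xV: "x \<in> V" "B u x = 0" by (auto simp: ortho_def)
    \<comment> \<open>The claim is made for arbitrary lists \<open>K\<close> to allow induction, and
      includes membership in \<open>V\<close> because \<open>proj_lin\<close> requires it.\<close>
    have "(\<Sum>p\<leftarrow>K. s (B (fst p) x) (snd p)) \<in> V \<and> proj d u (\<Sum>p\<leftarrow>K. s (B (fst p) x) (snd p)) =
        (\<Sum>p\<leftarrow>map (\<lambda>p. (proj d u (fst p), proj d u (snd p))) K. s (B (fst p) x) (snd p))"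
      if "set K \<subseteq> V \<times> V" for K
      using that
    proof (induction K)
      case Nil
      then show ?case using xV by (simp add: proj_def u)
    next
      case (Cons p K)
      then have p: "fst p \<in> V" "snd p \<in> V" by auto
      then have "B (proj d u (fst p)) x = B (fst p) x" using xV u by (simp add: proj_def)
      then show ?case using Cons p u by (simp add: proj_lin)
    qed
    from this[OF L(1)] have "proj d u x = (\<Sum>p\<leftarrow>L'. s (B (fst p) x) (snd p))"
      using L(2)[OF xV(1)] by (simp add: L'_def)
    then show "x = (\<Sum>p\<leftarrow>L'. s (B (fst p) x) (snd p))" using x by simp
  qed
  then show ?thesis by unfold_locales blast
qed

section \<open>Witt extension\<close>

context nonsing_space
begin

text \<open>With \<open>c = q u\<close> and \<open>p = B u v\<close> one has
  \<open>q (u - v) = 2 * c - p\<close> and \<open>q (- u - v) = 2 * c + p\<close>. Where the latter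
  vanishes, \<open>gen\<close> supplies an anisotropic vector orthogonal to \<open>u\<close>, and
  the first reflection leaves \<open>u\<close> in place; elsewhere it reverses
  \<open>u\<close>.\<close>

lemma move_vector_generic:
  assumes semiloc: "semi_local TYPE('a)"
    and uv: "u \<in> V" "v \<in> V" "q u = q v"
    and e: "e * e = e" "s e u = u" "s e v = v" and d: "d * q u = e"
    and gen: "\<And>m. maximal_ideal m \<Longrightarrow> e \<notin> m \<Longrightarrow> B u v + 2 * q u \<in> m \<Longrightarrow> \<exists>x\<in>ortho u. q x \<notin> m"
  shows "\<exists>\<phi>. quad_aut s V q \<phi> \<and> \<phi> u = v"
proof -
  define c where "c = q u"
  define p where "p = B u v"
  define M where "M = {m :: 'a set. maximal_ideal m}"
  have "finite M" using semiloc by (simp add: M_def semi_local_def)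
  interpret U: quad_space s "ortho u" q h using uv by (intro ortho_quad_space)
  obtain w0 where w0: "w0 \<in> ortho u" "\<And>m. maximal_ideal m \<Longrightarrow> (\<exists>x\<in>ortho u. q x \<notin> m) \<Longrightarrow> q w0 \<notin> m"
    using U.unit_vector[OF semiloc] by blast
  \<comment> \<open>The factor \<open>e\<close> ensures \<open>s e y = y\<close> below, so that
    \<open>d1 * q y = e\<close> suffices for \<open>reflect_aut\<close>. It does no harm at the
    ideals without \<open>e\<close>.\<close>
  define w where "w = s e w0"
  have w: "w \<in> V" "B u w = 0" "s e w = w"
    using w0(1) uv e(1) by (auto simp: w_def ortho_def)
  have qw: "q w \<notin> m" if "maximal_ideal m" "e \<notin> m" "p + 2 * c \<in> m" for m
    using gen[OF that(1,2)] that w0 by (simp add: w_def c_def p_def maximal_ideal_mult_iff ortho_def)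
  define M1 where "M1 = {m \<in> M. p + 2 * c \<in> m}"
  have fin: "finite M1" "finite (M - M1)" using \<open>finite M\<close> by (auto simp: M1_def)
  have max: "maximal_ideal m" if "m \<in> M1 \<union> (M - M1)" for m using that by (auto simp: M_def M1_def)
  \<comment> \<open>\<open>a\<close> vanishes exactly at the ideals of \<open>M1\<close>,
    \<open>b\<close> exactly at the others; so modulo each ideal \<open>y\<close> is a nonzero
    multiple of either \<open>w\<close> or \<open>u\<close>.\<close>
  have "\<exists>a. (\<forall>m\<in>M - M1. a \<notin> m) \<and> (\<forall>m\<in>M1. a \<in> m)"
    using fin max by (intro maximal_ideals_separate) auto
  then obtain a where "\<forall>m\<in>M - M1. a \<notin> m" "\<forall>m\<in>M1. a \<in> m" by blast
  then have a: "a \<in> m \<longleftrightarrow> p + 2 * c \<in> m" if "maximal_ideal m" for m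
    using that by (auto simp: M1_def M_def)
  have "\<exists>b. (\<forall>m\<in>M1. b \<notin> m) \<and> (\<forall>m\<in>M - M1. b \<in> m)"
    using fin max by (intro maximal_ideals_separate) auto
  then obtain b where "\<forall>m\<in>M1. b \<notin> m" "\<forall>m\<in>M - M1. b \<in> m" by blast
  then have b: "b \<in> m \<longleftrightarrow> p + 2 * c \<notin> m" if "maximal_ideal m" for m
    using that by (auto simp: M1_def M_def)
  have cm: "c \<notin> m" if "maximal_ideal m" "e \<notin> m" for m
    using that d maximal_ideal_mult_iff[OF that(1)] by (metis c_def)
  define y where "y = s a u + s b w"
  have y: "y \<in> V" "s e y = y"
    using uv w by (simp_all only: y_def closed scale_right_distrib scale_left_commute[of e] e)
  have qy: "q y = a * a * c + b * b * q w"
    using uv w by (simp add: y_def q_add c_def)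
  have "q y \<notin> m" if m: "maximal_ideal m" "e \<notin> m" for m
  proof -
    have idl: "ring_ideal m" using m maximal_ideal_ideal by blast
    show ?thesis
    proof (cases "p + 2 * c \<in> m")
      case True
      then have "b * b * q w \<notin> m" using b[OF m(1)] qw[OF m] by (simp add: maximal_ideal_mult_iff[OF m(1)])
      moreover have "a * a * c \<in> m" using a[OF m(1)] True by (simp add: maximal_ideal_mult_iff[OF m(1)])
      moreover have "b * b * q w = q y - a * a * c" by (simp add: qy)
      ultimately show ?thesis using ring_ideal_diff[OF idl] by metis
    next
      case False
      then have "a * a * c \<notin> m" using a[OF m(1)] cm[OF m] by (simp add: maximal_ideal_mult_iff[OF m(1)])
      moreover have "b * b * q w \<in> m" using b[OF m(1)] False by (simp add: maximal_ideal_mult_iff[OF m(1)])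
      moreover have "a * a * c = q y - b * b * q w" by (simp add: qy)
      ultimately show ?thesis using ring_ideal_diff[OF idl] by metis
    qed
  qed
  then obtain d1 where d1: "d1 * q y = e" using unit_on_idempotent[OF e(1)] by blast
  define z where "z = reflect d1 y u - v"
  have z: "z \<in> V" "s e z = z"
    using y uv by (simp_all only: z_def reflect_def closed scale_right_diff_distrib scale_left_commute[of e] e)
  define r where "r = B w v"
  have aut1: "quad_aut s V q (reflect d1 y)" using y d1 by (intro reflect_aut) auto
  then have hom1: "quad_hom s V q s V q (reflect d1 y)" by (rule quad_aut_hom)
  then have u1: "reflect d1 y u \<in> V" "q (reflect d1 y u) = c"
    using uv by (auto simp: quad_hom_def c_def)
  have ep: "e * p = p" "e * r = r"
    using e(3) B_bilin(4)[of u v e] B_bilin(4)[of w v e] uv w by (auto simp: p_def r_def)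
  \<comment> \<open>Both vectors in \<open>z\<close> have norm \<open>c\<close>, so
    \<open>q z\<close> is \<open>2 * c\<close> minus their pairing; the correction comes from
    \<open>B u y = 2 * a * c\<close> and \<open>B y v = a * p + b * r\<close>.\<close>
  have qz: "q z = 2 * c - p + 2 * a * c * d1 * (a * p + b * r)"
  proof -
    have "B (reflect d1 y u) v = p - d1 * (2 * a * c) * (a * p + b * r)"
      using uv w y by (simp add: reflect_def c_def p_def r_def) (simp add: y_def uv w algebra_simps)
    then show ?thesis
      using u1 uv by (simp add: z_def q_diff) (simp add: algebra_simps c_def)
  qed
  have "q z \<notin> m" if m: "maximal_ideal m" "e \<notin> m" for m
  proof
    have idl: "ring_ideal m" using m maximal_ideal_ideal by blast
    have two: "2 \<notin> m" using maximal_ideal_two[OF m(1) half] .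
    assume qz_m: "q z \<in> m"
    show False
    proof (cases "p + 2 * c \<in> m")
      case True
      then have "a \<in> m" using a[OF m(1)] by simp
      \<comment> \<open>As \<open>a\<close> lies in \<open>m\<close>, \<open>q z\<close> is
        congruent to \<open>2 * c - p\<close>, which is congruent to \<open>4 * c\<close> because
        \<open>p\<close> is congruent to \<open>- 2 * c\<close>.\<close>
      have "2 * (2 * c) = q z + (p + 2 * c) - (2 * c * d1 * (a * p + b * r)) * a"
        by (simp add: qz algebra_simps)
      also have "\<dots> \<in> m" by (intro ring_ideal_diff[OF idl] ring_ideal_add[OF idl] ring_ideal_mult[OF idl \<open>a \<in> m\<close>] qz_m True)
      finally show False using cm[OF m] two maximal_ideal_mult_iff[OF m(1)] by blast
    next
      case False
      then have "b \<in> m" using b[OF m(1)] by simp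
      \<comment> \<open>Multiplying by \<open>q y\<close> eliminates \<open>d1\<close>, and
        \<open>ep\<close> absorbs the resulting \<open>e\<close>. As \<open>b\<close> lies in
        \<open>m\<close>, what remains modulo \<open>m\<close> is
        \<open>a * a * c * (2 * c - p + 2 * p)\<close>.\<close>
      have "q y * q z = q y * (2 * c - p) + 2 * a * c * (d1 * q y) * (a * p + b * r)"
        by (simp add: qz algebra_simps)
      also have "\<dots> = q y * (2 * c - p) + 2 * a * c * (a * (e * p) + b * (e * r))"
        unfolding d1 by (simp add: algebra_simps)
      also have "\<dots> = a * a * c * (p + 2 * c) + (b * q w * (2 * c - p) + 2 * a * c * r) * b"
        unfolding ep by (simp add: qy algebra_simps)
      finally have "a * a * c * (p + 2 * c) =
          q y * q z - (b * q w * (2 * c - p) + 2 * a * c * r) * b" by simp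
      also have "\<dots> \<in> m" by (intro ring_ideal_diff[OF idl] ring_ideal_mult[OF idl \<open>b \<in> m\<close>] ring_ideal_mult[OF idl qz_m])
      finally show False using cm[OF m] a[OF m(1)] False
        by (simp add: maximal_ideal_mult_iff[OF m(1)])
    qed
  qed
  then obtain d2 where d2: "d2 * q z = e" using unit_on_idempotent[OF e(1)] by blast
  have aut2: "quad_aut s V q (reflect d2 z)" using z d2 by (intro reflect_aut) auto
  \<comment> \<open>Equality of norms makes the pairing with the difference equal to
    \<open>q z\<close>, so the second reflection subtracts exactly
    \<open>s (d2 * q z) z = z\<close>.\<close>
  have "B (reflect d1 y u) z = q z"
    using u1 uv by (simp add: z_def q_diff c_def)
  then have "reflect d2 z (reflect d1 y u) = v"
    using d2 z by (simp add: reflect_def[of d2]) (simp add: z_def)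
  then show ?thesis using quad_aut_comp[OF aut1 aut2] by blast
qed

text \<open>Hypothesis \<open>gen\<close> of \<open>move_vector_generic\<close> can fail only where
  \<open>ortho u\<close> vanishes. There \<open>v\<close> is a multiple of \<open>u\<close>, and
  replacing \<open>u\<close> by \<open>s \<mu> u\<close>, with a global scalar \<open>\<mu>\<close>
  of square 1, makes the two agree.\<close>

lemma move_vector:
  assumes semiloc: "semi_local TYPE('a)"
    and uv: "u \<in> V" "v \<in> V" "q u = q v"
    and e: "e * e = e" "s e u = u" "s e v = v" and d: "d * q u = e"
  shows "\<exists>\<phi>. quad_aut s V q \<phi> \<and> \<phi> u = v"
proof -
  define c where "c = q u"
  define p where "p = B u v"
  have du: "s (d * q u) u = u" using d e by simp
  interpret U: nonsing_space s "ortho u" q h using uv du by (intro ortho_nonsing_space)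
  obtain k where k: "k * k = k" "\<And>x. x \<in> ortho u \<Longrightarrow> s k x = x"
    "\<And>m. maximal_ideal m \<Longrightarrow> k \<notin> m \<Longrightarrow> \<exists>x\<in>ortho u. q x \<notin> m"
    using U.support_idempotent by blast
  define t where "t = h * (d * p)"
  \<comment> \<open>\<open>k\<close> is the support of \<open>ortho u\<close>, so \<open>f\<close>
    cuts out the part of the support of \<open>u\<close> on which the complement vanishes;
    \<open>t\<close> is the coefficient of \<open>v\<close> along \<open>u\<close>.\<close>
  define f where "f = (1 - k) * e"
  have f: "f * f = f"
  proof -
    have "f * f = (1 - k - k + k * k) * (e * e)" by (simp add: f_def algebra_simps)
    then show ?thesis unfolding k(1) e(1) by (simp add: f_def)
  qed
  have fv: "s f v = s (f * t) u"
  proof -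
    have "s k (proj d u v) = proj d u v" using k proj_in_ortho[OF uv(1) du uv(2)] by blast
    then have "s (1 - k) v = s ((1 - k) * t) u"
      by (simp add: proj_def t_def p_def algebra_simps scale_right_diff_distrib scale_left_diff_distrib)
    then have "s e (s (1 - k) v) = s e (s ((1 - k) * t) u)" by simp
    then show ?thesis by (simp add: f_def mult_ac)
  qed
  have ec: "d * c = e" using d by (simp add: c_def)
  \<comment> \<open>Taking norms in \<open>fv\<close> gives \<open>t * t * c = c\<close> on the part
    cut out by \<open>f\<close>; there \<open>c\<close> is cancelled by \<open>d\<close>.\<close>
  have ftt: "f * t * t = f"
  proof -
    have "q (s f v) = q (s (f * t) u)" using fv by simp
    then have "(f * f) * c = (f * f) * t * t * c" using uv by (simp add: c_def algebra_simps)
    then have "d * (f * c) = d * (f * t * t * c)" unfolding f by simp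
    then have "f * (d * c) = f * t * t * (d * c)" by (simp add: mult_ac)
    then have "f * e = f * t * t * e" unfolding ec .
    moreover have "f * t * t * e = f * e * t * t" by (simp only: mult_ac)
    moreover have "f * e = f" using e by (simp add: f_def mult.assoc)
    ultimately show ?thesis by simp
  qed
  \<comment> \<open>multiplication by t where the complement of u vanishes, and the identity elsewhere\<close>
  define \<mu> where "\<mu> = 1 + f * (t - 1)"
  have \<mu>: "\<mu> * \<mu> = 1"
  proof -
    have "\<mu> * \<mu> = 1 + 2 * (f * (t - 1)) + f * f * (t - 1) * (t - 1)"
      by (simp add: \<mu>_def algebra_simps)
    also have "\<dots> = 1 + (f * t * t - f)" unfolding f by (simp add: algebra_simps)
    finally show ?thesis by (simp add: ftt)
  qed
  have "\<exists>\<phi>. quad_aut s V q \<phi> \<and> \<phi> (s \<mu> u) = v"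
  proof (rule move_vector_generic[OF semiloc _ uv(2) _ e(1) _ e(3)])
    show "s \<mu> u \<in> V" "s e (s \<mu> u) = s \<mu> u"
      using uv by (simp_all only: closed scale_left_commute[of e] e)
    show qu: "q (s \<mu> u) = q v" using uv by (simp add: \<mu>)
    show "d * q (s \<mu> u) = e" using qu uv d by simp
    fix m assume m: "maximal_ideal m" "e \<notin> m" "B (s \<mu> u) v + 2 * q (s \<mu> u) \<in> m"
    have idl: "ring_ideal m" using m maximal_ideal_ideal by blast
    have "B (s \<mu> u) v + 2 * q (s \<mu> u) = \<mu> * p + 2 * c" using uv by (simp add: \<mu> p_def c_def)
    then have in_m: "\<mu> * p + 2 * c \<in> m" using m by simp
    \<comment> \<open>If \<open>k\<close> were in \<open>m\<close>, then \<open>f\<close> would not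
      be. But after multiplication by \<open>f\<close>, \<open>\<mu> * p\<close> becomes
      \<open>t * p\<close>, which equals \<open>2 * c\<close>, so \<open>\<mu> * p + 2 * c\<close>
      would be congruent to \<open>4 * c\<close>, which is nonzero modulo \<open>m\<close>.\<close>
    have "k \<notin> m"
    proof
      assume "k \<in> m"
      have fp: "f * p = f * t * (2 * c)"
        using arg_cong[OF fv, of "B u"] uv by (simp add: p_def c_def)
      have "f * (\<mu> * p + 2 * c) = f * p + f * f * (t - 1) * p + 2 * (f * c)"
        by (simp add: \<mu>_def algebra_simps)
      also have "\<dots> = (f * p) * t + 2 * (f * c)" unfolding f by (simp add: algebra_simps)
      also have "\<dots> = (f * t * t) * (2 * c) + 2 * (f * c)" unfolding fp by (simp add: algebra_simps)
      also have "\<dots> = 2 * (2 * (f * c))" unfolding ftt by (simp add: algebra_simps)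
      finally have "2 * (2 * (f * c)) \<in> m" using in_m idl ring_ideal_mult by metis
      then have "f \<in> m \<or> c \<in> m" using maximal_ideal_two[OF m(1) half] maximal_ideal_mult_iff[OF m(1)] by blast
      moreover have "c \<notin> m" using ec m(2) maximal_ideal_mult_iff[OF m(1)] by metis
      moreover have "1 - k \<notin> m"
        using ring_ideal_add[OF idl, of "1 - k" k] \<open>k \<in> m\<close> maximal_ideal_one[OF m(1)] by auto
      ultimately show False using m(2) by (simp add: f_def maximal_ideal_mult_iff[OF m(1)])
    qed
    then obtain x where "x \<in> ortho u" "q x \<notin> m" using k(3) m(1) by blast
    moreover have "ortho u \<subseteq> ortho (s \<mu> u)" using uv by (auto simp: ortho_def)
    ultimately show "\<exists>x\<in>ortho (s \<mu> u). q x \<notin> m" by blast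
  qed
  then obtain \<phi> where "quad_aut s V q \<phi>" "\<phi> (s \<mu> u) = v" by blast
  then show ?thesis using quad_aut_comp[OF scalar_aut[OF \<mu>]] by blast
qed

end

section \<open>Rank modulo maximal ideals, and induction on it\<close>

text \<open>This says that the reduction of q modulo m has rank at most n, without forming the quotient.\<close>

definition detecting :: "'a::comm_ring_1 set \<Rightarrow> 'v::ab_group_add set \<Rightarrow> ('v \<Rightarrow> 'a) \<Rightarrow> nat \<Rightarrow> bool" where
  "detecting m V q n \<longleftrightarrow> (\<exists>S\<subseteq>V. finite S \<and> card S \<le> n \<and>
     (\<forall>x\<in>V. (\<forall>y\<in>S. polar q x y \<in> m) \<longrightarrow> (\<forall>y\<in>V. polar q x y \<in> m)))"

text \<open>An exchange argument. Since \<open>B x x\<close> is nonzero modulo \<open>m\<close>,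
  some test vector \<open>t\<close> sees \<open>x\<close>; it is used up to make the other test
  vectors orthogonal to \<open>x\<close>. Scaling by \<open>B x t\<close> avoids division.\<close>

lemma (in quad_space) detecting_ortho:
  assumes m: "maximal_ideal m" and x: "x \<in> V" "q x \<notin> m" and det: "detecting m V q (Suc n)"
  shows "detecting m (ortho x) q n"
proof -
  have idl: "ring_ideal m" using m by (rule maximal_ideal_ideal)
  note two = maximal_ideal_two[OF m half] and prime = maximal_ideal_mult_iff[OF m]
  obtain S where S: "S \<subseteq> V" "finite S" "card S \<le> Suc n"
    and "\<forall>x\<in>V. (\<forall>y\<in>S. B x y \<in> m) \<longrightarrow> (\<forall>y\<in>V. B x y \<in> m)"
    using det unfolding detecting_def by blast
  then have dt: "B x y \<in> m" if "x \<in> V" "\<And>y. y \<in> S \<Longrightarrow> B x y \<in> m" "y \<in> V" for x y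
    using that by blast
  have "B x x \<notin> m" using x two by (simp add: prime)
  then obtain t where t: "t \<in> S" "B x t \<notin> m" using dt x(1) by blast
  then have tV: "t \<in> V" using S by blast
  define g where "g = (\<lambda>y. s (B x t) y - s (B x y) t)"
  have 1: "g ` (S - {t}) \<subseteq> ortho x"
    using S x tV by (auto simp: g_def ortho_def subset_iff)
  have 2: "card (g ` (S - {t})) \<le> n"
    using card_image_le[of "S - {t}" g] S t by simp
  have 3: "B z y \<in> m" if z: "z \<in> ortho x" "\<And>y. y \<in> g ` (S - {t}) \<Longrightarrow> B z y \<in> m" and y: "y \<in> ortho x" for z y
  proof -
    have zV: "z \<in> V" "B x z = 0" "B z x = 0" "y \<in> V" using z y by (auto simp: ortho_def polar_commute[of q z])
    \<comment> \<open>\<open>z'\<close> pairs to zero with \<open>t\<close> and with any other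
      \<open>y'\<close> as \<open>z\<close> does with \<open>g y'\<close>, so it passes all the old
      tests. Testing it against \<open>x\<close> then shows that \<open>B z t\<close> lies in
      \<open>m\<close>, and the claim passes from \<open>z'\<close> back to
      \<open>z\<close>.\<close>
    define z' where "z' = s (B x t) z - s (B z t) x"
    have z': "z' \<in> V" using zV x by (simp add: z'_def)
    have "B z' y' \<in> m" if y': "y' \<in> S" for y'
    proof (cases "y' = t")
      case True
      then show ?thesis using zV x tV ring_ideal_zero[OF idl] by (simp add: z'_def)
    next
      case False
      then have "B z (g y') \<in> m" using z y' by blast
      moreover have "B z (g y') = B z' y'"
        using y' S zV x tV by (auto simp: g_def z'_def algebra_simps subset_iff)
      ultimately show ?thesis by simp
    qed
    then have K: "B z' y \<in> m" if "y \<in> V" for y using dt[OF z'] that by blast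
    have "B z' x = - (2 * (B z t * q x))" using zV x by (simp add: z'_def algebra_simps)
    then have "2 * (B z t * q x) \<in> m" using K[OF x(1)] ring_ideal_minus[OF idl] by fastforce
    then have "B z t \<in> m" using two x by (simp add: prime)
    have "B x t * B z y = B z' y + B x y * B z t" using zV x by (simp add: z'_def)
    also have "\<dots> \<in> m" by (intro ring_ideal_add[OF idl] ring_ideal_mult[OF idl \<open>B z t \<in> m\<close>] K[OF zV(4)])
    finally show ?thesis using t by (simp add: prime)
  qed
  show ?thesis
    unfolding detecting_def
  proof (intro exI[of _ "g ` (S - {t})"] conjI ballI impI)
    fix z y assume z: "z \<in> ortho x" and zS: "\<forall>y\<in>g ` (S - {t}). B z y \<in> m" and y: "y \<in> ortho x"
    show "B z y \<in> m" by (rule 3[OF z _ y]) (rule bspec[OF zS])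
  qed (use 1 2 S(2) in simp_all)
qed

text \<open>Expanding \<open>x\<close> along a frame writes \<open>B y x\<close> in terms of the
  values \<open>B (fst p) x\<close>, so the first components serve as test vectors at every ideal.
  The induction needs this bound to be uniform in \<open>m\<close>.\<close>

lemma (in nonsing_space) detecting_frame:
  "\<exists>n. \<forall>m. ring_ideal m \<longrightarrow> detecting m V q n"
proof -
  obtain L where L: "set L \<subseteq> V \<times> V" "\<And>x. x \<in> V \<Longrightarrow> x = (\<Sum>p\<leftarrow>L. s (B (fst p) x) (snd p))"
    using frame unfolding frame_def by blast
  have "detecting m V q (length L)" if m: "ring_ideal m" for m
    unfolding detecting_def
  proof (intro exI[of _ "fst ` set L"] conjI ballI impI)
    show "card (fst ` set L) \<le> length L"
      using card_image_le[of "set L" fst] card_length[of L] by simp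
    fix x y assume x: "x \<in> V" and y: "y \<in> V" and S: "\<forall>y\<in>fst ` set L. B x y \<in> m"
    have "B y x = B y (\<Sum>p\<leftarrow>L. s (B (fst p) x) (snd p))" using L(2)[OF x] by simp
    also have "\<dots> = (\<Sum>p\<leftarrow>L. B y (s (B (fst p) x) (snd p)))"
      using L(1) y by (intro B_sum_list) auto
    also have "\<dots> \<in> m"
    proof (rule ring_ideal_sum_list[OF m])
      fix p assume p: "p \<in> set L"
      then have "fst p \<in> V" "B (fst p) x \<in> m" using S L(1) by (auto simp add: polar_commute[of q _ x])
      moreover have "snd p \<in> V" using p L(1) by auto
      ultimately show "B y (s (B (fst p) x) (snd p)) \<in> m"
        using y \<open>fst p \<in> V\<close> ring_ideal_mult'[OF m] by simp
    qed
    finally show "B x y \<in> m" by (simp add: polar_commute[of q x])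
  qed (use L(1) in auto)
  then show ?thesis by blast
qed

text \<open>Induction on a common bound for the rank at all maximal ideals, with both modules
  varying because the step passes to complements of \<open>x\<close> and \<open>g x\<close>. The
  chosen \<open>x\<close> is anisotropic wherever \<open>V\<close> has an anisotropic vector, so the
  bound drops at all ideals at once.\<close>

theorem witt_extension:
  fixes s :: "'a::comm_ring_1 \<Rightarrow> 'v::ab_group_add \<Rightarrow> 'v" and t :: "'a \<Rightarrow> 'w::ab_group_add \<Rightarrow> 'w"
  assumes semiloc: "semi_local TYPE('a)"
    and "nonsing_space s V q h" "nonsing_space t W r h"
    and "\<And>m. maximal_ideal m \<Longrightarrow> detecting m V q n"
    and "quad_hom s V q t W r f" "quad_hom s V q t W r g"
  shows "\<exists>\<phi>. quad_aut t W r \<phi> \<and> (\<forall>x\<in>V. \<phi> (f x) = g x)"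
  using assms(2-)
proof (induction n arbitrary: V W f g)
  case 0
  interpret X: nonsing_space s V q h by fact
  interpret Y: nonsing_space t W r h by fact
  obtain e where e: "e * e = e" "\<And>x. x \<in> V \<Longrightarrow> s e x = x"
    "\<And>m. maximal_ideal m \<Longrightarrow> e \<notin> m \<Longrightarrow> \<exists>x\<in>V. q x \<notin> m"
    using X.support_idempotent by blast
  have "e \<in> m" if m: "maximal_ideal m" for m
  proof (rule ccontr)
    assume "e \<notin> m"
    then obtain x where x: "x \<in> V" "q x \<notin> m" using e m by blast
    have "\<forall>x\<in>V. \<forall>y\<in>V. polar q x y \<in> m" using 0(3)[OF m] unfolding detecting_def by auto
    then have "X.B x x \<in> m" using x(1) by blast
    then show False using x maximal_ideal_two[OF m X.half] by (simp add: maximal_ideal_mult_iff[OF m])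
  qed
  \<comment> \<open>As \<open>e\<close> lies in every maximal ideal, the hypothesis of
    \<open>unit_on_idempotent\<close> is vacuous even for the element 0; this forces
    \<open>e = 0\<close> and \<open>V = {0}\<close>.\<close>
  then obtain d where "d * 0 = e" using unit_on_idempotent[OF e(1), of 0] by blast
  then have zero: "x = 0" if "x \<in> V" for x using e(2)[OF that] by simp
  have "f (0 + 0) = f 0 + f 0" "g (0 + 0) = g 0 + g 0"
    using 0(4,5) X.closed(1) unfolding quad_hom_def lin_on_def by blast+
  then have "f x = g x" if "x \<in> V" for x using zero[OF that] by simp
  then show ?case using quad_aut_id by blast
next
  case (Suc n)
  interpret X: nonsing_space s V q h by fact
  interpret Y: nonsing_space t W r h by fact
  obtain e where e: "e * e = e" "\<And>x. x \<in> V \<Longrightarrow> s e x = x"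
    "\<And>m. maximal_ideal m \<Longrightarrow> e \<notin> m \<Longrightarrow> \<exists>x\<in>V. q x \<notin> m"
    using X.support_idempotent by blast
  obtain x where x: "x \<in> V" "\<And>m. maximal_ideal m \<Longrightarrow> (\<exists>x\<in>V. q x \<notin> m) \<Longrightarrow> q x \<notin> m"
    using X.unit_vector[OF semiloc] by blast
  obtain d where d: "d * q x = e" using unit_on_idempotent[OF e(1)] e(3) x(2) by blast
  have f: "\<And>x. x \<in> V \<Longrightarrow> f x \<in> W" "\<And>x. x \<in> V \<Longrightarrow> r (f x) = q x" "\<And>a x. x \<in> V \<Longrightarrow> f (s a x) = t a (f x)"
    using Suc.prems(4) unfolding quad_hom_def lin_on_def by blast+
  have g: "\<And>x. x \<in> V \<Longrightarrow> g x \<in> W" "\<And>x. x \<in> V \<Longrightarrow> r (g x) = q x" "\<And>a x. x \<in> V \<Longrightarrow> g (s a x) = t a (g x)"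
    "\<And>x y. x \<in> V \<Longrightarrow> y \<in> V \<Longrightarrow> g (x + y) = g x + g y"
    using Suc.prems(5) unfolding quad_hom_def lin_on_def by blast+
  have "\<exists>\<phi>. quad_aut t W r \<phi> \<and> \<phi> (f x) = g x"
    using f g x(1) d e(2)[OF x(1)] by (intro Y.move_vector[OF semiloc _ _ _ e(1), of _ _ d]) metis+
  then obtain \<phi> where \<phi>: "quad_aut t W r \<phi>" "\<phi> (f x) = g x" by blast
  define f1 where "f1 = (\<lambda>x. \<phi> (f x))"
  have f1: "quad_hom s V q t W r f1"
    unfolding f1_def using quad_hom_comp[OF Suc.prems(4) quad_aut_hom[OF \<phi>(1)]] .
  have dx: "s (d * q x) x = x" using d e x by simp
  have dgx: "t (d * r (g x)) (g x) = g x" using dx g x(1) by metis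
  \<comment> \<open>Stated for a variable \<open>k\<close> because both the corrected map
    \<open>f1\<close> and \<open>g\<close> have to be restricted.\<close>
  have restr: "quad_hom s (X.ortho x) q t (Y.ortho (g x)) r k"
    if k: "quad_hom s V q t W r k" "k x = g x" for k
  proof -
    have "polar r (g x) (k y) = polar q x y" if "y \<in> V" for y
      using quad_hom_polar[OF k(1) x(1) that] k(2) x(1) that by simp
    then show ?thesis
      using k unfolding quad_hom_def lin_on_def X.ortho_def Y.ortho_def by simp
  qed
  have det: "detecting m (X.ortho x) q n" if m: "maximal_ideal m" for m
  proof (cases "q x \<in> m")
    case False
    then show ?thesis using X.detecting_ortho[OF m x(1) _ Suc.prems(3)[OF m]] by blast
  next
    case True
    \<comment> \<open>If \<open>x\<close> is isotropic modulo \<open>m\<close>, so is all of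
      \<open>V\<close>; the form vanishes there and no test vector is needed.\<close>
    then have "polar q y z \<in> m" if "y \<in> V" "z \<in> V" for y z
      using X.q_not_in[OF m that] x(2)[OF m] by blast
    then show ?thesis unfolding detecting_def X.ortho_def by (intro exI[of _ "{}"]) auto
  qed
  \<comment> \<open>\<open>\<psi>\<close> corrects \<open>f1\<close> to \<open>g\<close> on the
    complement; its extension \<open>F\<close> fixes \<open>g x\<close>, so the agreement at
    \<open>x\<close> survives.\<close>
  have "\<exists>\<psi>. quad_aut t (Y.ortho (g x)) r \<psi> \<and> (\<forall>y\<in>X.ortho x. \<psi> (f1 y) = g y)"
    using X.ortho_nonsing_space[OF x(1) dx] Y.ortho_nonsing_space[OF g(1)[OF x(1)] dgx]
      det restr[OF f1] restr[OF Suc.prems(5)] \<phi>(2)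
    by (intro Suc.IH) (auto simp: f1_def)
  then obtain \<psi> where \<psi>: "quad_aut t (Y.ortho (g x)) r \<psi>" "\<And>y. y \<in> X.ortho x \<Longrightarrow> \<psi> (f1 y) = g y"
    by blast
  obtain F where F: "quad_aut t W r F" "F (g x) = g x" "\<And>y. y \<in> Y.ortho (g x) \<Longrightarrow> F y = \<psi> y"
    using Y.extend_aut[OF g(1)[OF x(1)] dgx \<psi>(1)] by blast
  have comp: "quad_hom s V q t W r (\<lambda>y. F (f1 y))"
    using quad_hom_comp[OF f1 quad_aut_hom[OF F(1)]] .
  have "F (\<phi> (f y)) = g y" if y: "y \<in> V" for y
  proof -
    let ?p = "X.proj d x y" and ?a = "h * (d * polar q x y)"
    have p: "?p \<in> X.ortho x" using X.proj_in_ortho[OF x(1) dx y] .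
    then have pV: "?p \<in> V" by (simp add: X.ortho_def)
    have "f1 ?p \<in> Y.ortho (g x)" using restr[OF f1] \<phi>(2) p unfolding f1_def quad_hom_def by blast
    then have Fp: "F (f1 ?p) = g ?p" using F(3) \<psi>(2)[OF p] by simp
    have Fx: "F (f1 x) = g x" using F(2) \<phi>(2) by (simp add: f1_def)
    have "F (f1 y) = F (f1 (?p + s ?a x))" by (simp add: X.proj_add_scale)
    also have "\<dots> = F (f1 ?p) + t ?a (F (f1 x))"
      using comp pV x(1) unfolding quad_hom_def lin_on_def by simp
    also have "\<dots> = g (?p + s ?a x)" using Fp Fx g pV x(1) by simp
    finally show ?thesis by (simp add: X.proj_add_scale f1_def)
  qed
  then show ?case using quad_aut_comp[OF \<phi>(1) F(1)] by blast
qed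

section \<open>Quadratic modules and orthogonal sums\<close>

text \<open>The coordinates of the split embedding into \<open>R^n\<close> are functionals on
  \<open>V\<close>, represented by vectors \<open>y k\<close> since \<open>q\<close> is
  non-singular; their partners are the images under \<open>p\<close> of the unit vectors.\<close>

lemma frame_of_quad_module:
  fixes s :: "'a::comm_ring_1 \<Rightarrow> 'v::ab_group_add \<Rightarrow> 'v"
  assumes mod: "module s" and V: "quad_module s V q"
  shows "\<exists>L. frame s V q L"
proof -
  interpret module s by fact
  obtain n and i :: "'v \<Rightarrow> nat \<Rightarrow> 'a" and p where
    i: "\<forall>x\<in>V. i x \<in> free_mod n" "\<forall>x\<in>V. \<forall>y\<in>V. i (x + y) = (\<lambda>k. i x k + i y k)"
      "\<forall>a. \<forall>x\<in>V. i (s a x) = (\<lambda>k. a * i x k)"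
    and p: "\<forall>f\<in>free_mod n. p f \<in> V"
      "\<forall>f\<in>free_mod n. \<forall>g\<in>free_mod n. p (\<lambda>k. f k + g k) = p f + p g"
      "\<forall>a. \<forall>f\<in>free_mod n. p (\<lambda>k. a * f k) = s a (p f)"
    and pi: "\<forall>x\<in>V. p (i x) = x"
    using V unfolding quad_module_def fg_projective_def by blast
  have sub: "subspace V" and ns: "non_singular s V q" using V unfolding quad_module_def by auto
  define \<delta> where "\<delta> = (\<lambda>k j :: nat. if j = k then 1 else 0 :: 'a)"
  have \<delta>: "\<delta> k \<in> free_mod n" if "k < n" for k
    using that by (auto simp: \<delta>_def free_mod_def)
  have dual_in: "restrict (\<lambda>x. i x k) V \<in> dual s V" for k
    using i(2,3) sub unfolding dual_def lin_on_def
    by (auto simp: subspace_add subspace_scale)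
  have "\<exists>y\<in>V. \<forall>x\<in>V. polar q y x = i x k" for k
  proof -
    obtain y where "y \<in> V" "restrict (\<lambda>x. polar q y x) V = restrict (\<lambda>x. i x k) V"
      using ns dual_in[of k] unfolding non_singular_def bij_betw_def by (metis (no_types, lifting) imageE)
    then show ?thesis by (metis restrict_apply')
  qed
  then obtain y where y: "y k \<in> V" "\<And>x. x \<in> V \<Longrightarrow> polar q (y k) x = i x k" for k by metis
  have p0: "p (\<lambda>k. 0) = 0"
    using p(3)[rule_format, of "\<lambda>k. 0" 0] by (simp add: free_mod_def)
  \<comment> \<open>Induction on the number \<open>m\<close> of possibly nonzero coordinates with
    \<open>n\<close> fixed, since \<open>p\<close> is known to be linear only on
    \<open>free_mod n\<close>.\<close>
  have expand: "m \<le> n \<Longrightarrow> f \<in> free_mod m \<Longrightarrow> p f = (\<Sum>k\<leftarrow>[0..<m]. s (f k) (p (\<delta> k)))" for m f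
  proof (induction m arbitrary: f)
    case 0
    then have "f = (\<lambda>k. 0)" by (auto simp: free_mod_def)
    then show ?case by (simp add: p0)
  next
    case (Suc m)
    define g where "g = (\<lambda>k. if k = m then 0 else f k)"
    have g: "g \<in> free_mod m"
      unfolding free_mod_def
    proof (intro CollectI allI impI)
      fix k assume "m \<le> k"
      then show "g k = 0" using Suc.prems(2) by (cases "k = m") (auto simp: g_def free_mod_def)
    qed
    have gn: "g \<in> free_mod n" "(\<lambda>k. f m * \<delta> m k) \<in> free_mod n"
      using g Suc.prems(1) by (auto simp: free_mod_def \<delta>_def)
    have "f = (\<lambda>k. g k + f m * \<delta> m k)" by (auto simp: g_def \<delta>_def)
    then have "p f = p (\<lambda>k. g k + f m * \<delta> m k)" by (rule arg_cong)
    also have "\<dots> = p g + s (f m) (p (\<delta> m))"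
      using p(2,3) gn \<delta>[of m] Suc.prems(1) by simp
    also have "p g = (\<Sum>k\<leftarrow>[0..<m]. s (g k) (p (\<delta> k)))" using Suc g by simp
    also have "\<dots> = (\<Sum>k\<leftarrow>[0..<m]. s (f k) (p (\<delta> k)))"
      by (intro arg_cong[of _ _ sum_list] map_cong) (auto simp: g_def)
    finally show ?case by simp
  qed
  have "frame s V q (map (\<lambda>k. (y k, p (\<delta> k))) [0..<n])"
    unfolding frame_def
  proof (intro conjI ballI)
    show "set (map (\<lambda>k. (y k, p (\<delta> k))) [0..<n]) \<subseteq> V \<times> V"
      using y(1) p(1) \<delta> by auto
    fix x assume x: "x \<in> V"
    then have "x = (\<Sum>k\<leftarrow>[0..<n]. s (i x k) (p (\<delta> k)))"
      using pi i(1) expand[of n "i x"] by simp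
    then show "x = (\<Sum>p\<leftarrow>map (\<lambda>k. (y k, p (\<delta> k))) [0..<n]. s (polar q (fst p) x) (snd p))"
      using y(2)[OF x] by (simp add: comp_def)
  qed
  then show ?thesis by blast
qed

lemma nonsing_space_of_quad_module:
  fixes s :: "'a::comm_ring_1 \<Rightarrow> 'v::ab_group_add \<Rightarrow> 'v"
  assumes "module s" "quad_module s V q" "2 * h = (1 :: 'a)"
  shows "nonsing_space s V q h"
  using assms frame_of_quad_module[OF assms(1,2)]
  by (simp add: nonsing_space_def nonsing_space_axioms_def quad_space_def quad_space_axioms_def quad_module_def)

text \<open>The converse of \<open>frame_of_quad_module\<close>: pairing with the first components
  of a frame embeds \<open>V\<close> into \<open>R^n\<close>, and combining the second components
  splits this embedding.\<close>

lemma (in nonsing_space) quad_module: "quad_module s V q"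
proof -
  obtain L where L: "set L \<subseteq> V \<times> V" "\<And>x. x \<in> V \<Longrightarrow> x = (\<Sum>p\<leftarrow>L. s (B (fst p) x) (snd p))"
    using frame unfolding frame_def by blast
  define n where "n = length L"
  have Ln: "fst (L ! k) \<in> V" "snd (L ! k) \<in> V" if "k < n" for k
    using subsetD[OF L(1) nth_mem[of k L]] that by (auto simp: n_def mem_Times_iff)
  have Ls: "x = (\<Sum>k<n. s (B (fst (L ! k)) x) (snd (L ! k)))" if "x \<in> V" for x
    using L(2)[OF that] by (simp add: sum_list_sum_nth n_def atLeast0LessThan)
  have "fin_gen s V"
    unfolding fin_gen_def
  proof (intro exI[of _ "snd ` set L"] conjI)
    show "span (snd ` set L) = V"
    proof
      show "span (snd ` set L) \<subseteq> V" using L(1) sub by (intro span_minimal) auto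
      show "V \<subseteq> span (snd ` set L)"
      proof
        fix x assume "x \<in> V"
        have "(\<Sum>k<n. s (B (fst (L ! k)) x) (snd (L ! k))) \<in> span (snd ` set L)"
          by (intro span_sum span_scale span_base) (auto simp: n_def)
        then show "x \<in> span (snd ` set L)" using Ls[OF \<open>x \<in> V\<close>] by simp
      qed
    qed
  qed (use L in auto)
  moreover have "\<exists>n i p.
       (\<forall>x\<in>V. i x \<in> free_mod n) \<and>
       (\<forall>x\<in>V. \<forall>y\<in>V. i (x + y) = (\<lambda>k. i x k + i y k)) \<and>
       (\<forall>a. \<forall>x\<in>V. i (s a x) = (\<lambda>k. a * i x k)) \<and>
       (\<forall>f\<in>free_mod n. p f \<in> V) \<and>
       (\<forall>f\<in>free_mod n. \<forall>g\<in>free_mod n. p (\<lambda>k. f k + g k) = p f + p g) \<and>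
       (\<forall>a. \<forall>f\<in>free_mod n. p (\<lambda>k. a * f k) = s a (p f)) \<and>
       (\<forall>x\<in>V. p (i x) = x)"
  proof (intro exI conjI ballI allI)
    let ?i = "\<lambda>x k. if k < n then B (fst (L ! k)) x else 0"
    let ?p = "\<lambda>f. \<Sum>k<n. s (f k) (snd (L ! k))"
    fix x assume x: "x \<in> V"
    show "?i x \<in> free_mod n" by (simp add: free_mod_def)
    show "?i (x + y) = (\<lambda>k. ?i x k + ?i y k)" if "y \<in> V" for y
      using x that Ln by (intro ext) simp
    show "?i (s a x) = (\<lambda>k. a * ?i x k)" for a
      using x Ln by (intro ext) simp
    show "?p (?i x) = x" using Ls[OF x] by simp
  next
    let ?p = "\<lambda>f. \<Sum>k<n. s (f k) (snd (L ! k))"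
    fix f :: "nat \<Rightarrow> 'a"
    show "?p f \<in> V" using Ln sub by (intro subspace_sum) auto
    show "?p (\<lambda>k. f k + g k) = ?p f + ?p g" for g
      by (simp add: scale_left_distrib sum.distrib)
    show "?p (\<lambda>k. a * f k) = s a (?p f)" for a
      by (simp add: scale_sum_right)
  qed
  ultimately have "fg_projective s V" unfolding fg_projective_def by blast
  moreover have "non_singular s V q"
    unfolding non_singular_def bij_betw_def
  proof (intro conjI inj_onI equalityI subsetI)
    fix x y assume xy: "x \<in> V" "y \<in> V" "restrict (\<lambda>z. B x z) V = restrict (\<lambda>z. B y z) V"
    then have "B (x - y) z = 0" if "z \<in> V" for z
      using that by (simp add: fun_cong[OF xy(3), of z, simplified]) (metis restrict_apply')
    then show "x = y" using B_nondegenerate[of "x - y"] xy by simp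
  next
    fix \<phi> assume "\<phi> \<in> (\<lambda>x. restrict (\<lambda>z. B x z) V) ` V"
    then show "\<phi> \<in> dual s V" by (auto simp: dual_def lin_on_def)
  next
    fix \<phi> assume "\<phi> \<in> dual s V"
    then have ext: "\<phi> \<in> extensional V" and add: "\<And>x y. x \<in> V \<Longrightarrow> y \<in> V \<Longrightarrow> \<phi> (x + y) = \<phi> x + \<phi> y"
      and scale: "\<And>a x. x \<in> V \<Longrightarrow> \<phi> (s a x) = a * \<phi> x"
      by (auto simp: dual_def lin_on_def)
    have zero: "\<phi> 0 = 0" using scale[of 0 0] by simp
    \<comment> \<open>Applying \<open>\<phi>\<close> to the frame expansion of \<open>x\<close>
      shows that this vector must represent \<open>\<phi>\<close>.\<close>
    define y where "y = (\<Sum>p\<leftarrow>L. s (\<phi> (snd p)) (fst p))"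
    have key: "set K \<subseteq> V \<times> V \<Longrightarrow> (\<Sum>p\<leftarrow>K. s (B (fst p) x) (snd p)) \<in> V \<and>
       (\<Sum>p\<leftarrow>K. s (\<phi> (snd p)) (fst p)) \<in> V \<and>
      \<phi> (\<Sum>p\<leftarrow>K. s (B (fst p) x) (snd p)) = B (\<Sum>p\<leftarrow>K. s (\<phi> (snd p)) (fst p)) x" if "x \<in> V" for x K
      using that by (induction K) (auto simp: zero add scale mult.commute)
    have "\<phi> x = B y x" if "x \<in> V" for x
      using key[OF that L(1)] L(2)[OF that] by (simp add: y_def)
    then have "\<phi> = restrict (\<lambda>z. B y z) V"
      using ext by (auto simp: fun_eq_iff extensional_def)
    \<comment> \<open>Membership of \<open>y\<close> is the middle part of \<open>key\<close>, which
      does not mention \<open>x\<close>; hence the instance at 0.\<close>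
    moreover have "y \<in> V" using key[OF closed(1) L(1)] by (simp add: y_def)
    ultimately show "\<phi> \<in> (\<lambda>x. restrict (\<lambda>z. B x z) V) ` V" by blast
  qed
  ultimately show ?thesis using sub quad unfolding quad_module_def by blast
qed

section \<open>The zero module and orthogonal sums\<close>

lemma zero_nonsing_space:
  assumes "module s" "2 * h = (1 :: 'a::comm_ring_1)"
  shows "nonsing_space s {0 :: 'v::ab_group_add} (\<lambda>_. 0 :: 'a) h"
proof -
  interpret module s by fact
  show ?thesis
  proof
    show "\<exists>L. frame s {0} (\<lambda>_. 0) L"
      by (intro exI[of _ "[]"]) (simp add: frame_def)
    show "quad_form s {0} (\<lambda>_. 0)" by (simp add: quad_form_def polar_def)
  qed (use assms in \<open>auto simp: subspace_def\<close>)
qed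

lemma polar_orth_sum: "polar (orth_sum q r) p p' = polar q (fst p) (fst p') + polar r (snd p) (snd p')"
  by (simp add: polar_def orth_sum_def)

lemma prod_module: "module s \<Longrightarrow> module t \<Longrightarrow> module (prod_scale s t)"
  by (simp add: module_def prod_scale_def)

text \<open>Frames of the summands, padded with zeros and concatenated, form a frame of the sum,
  since the polar form is computed componentwise.\<close>

lemma prod_nonsing_space:
  fixes s :: "'a::comm_ring_1 \<Rightarrow> 'v::ab_group_add \<Rightarrow> 'v" and t :: "'a \<Rightarrow> 'w::ab_group_add \<Rightarrow> 'w"
  assumes "nonsing_space s V q h" "nonsing_space t W r h"
  shows "nonsing_space (prod_scale s t) (V \<times> W) (orth_sum q r) h"
proof -
  interpret X: nonsing_space s V q h by fact
  interpret Y: nonsing_space t W r h by fact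
  interpret P: module "prod_scale s t"
    by (intro prod_module) unfold_locales
  obtain L where L: "set L \<subseteq> V \<times> V" "\<And>x. x \<in> V \<Longrightarrow> x = (\<Sum>p\<leftarrow>L. s (polar q (fst p) x) (snd p))"
    using X.frame unfolding frame_def by blast
  obtain K where K: "set K \<subseteq> W \<times> W" "\<And>x. x \<in> W \<Longrightarrow> x = (\<Sum>p\<leftarrow>K. t (polar r (fst p) x) (snd p))"
    using Y.frame unfolding frame_def by blast
  define M where "M = map (\<lambda>p. ((fst p, 0 :: 'w), (snd p, 0 :: 'w))) L @ map (\<lambda>p. ((0 :: 'v, fst p), (0 :: 'v, snd p))) K"
  have "frame (prod_scale s t) (V \<times> W) (orth_sum q r) M"
    unfolding frame_def
  proof (intro conjI ballI)
    show "set M \<subseteq> (V \<times> W) \<times> (V \<times> W)" using L(1) K(1) by (auto simp: M_def)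
    fix z assume z: "z \<in> V \<times> W"
    then have z': "fst z \<in> V" "snd z \<in> W" by auto
    have 1: "(\<Sum>p\<leftarrow>L. (s (polar q (fst p) x) (snd p), 0 :: 'w)) = (\<Sum>p\<leftarrow>L. s (polar q (fst p) x) (snd p), 0)" for x
      by (induction L) (auto simp: zero_prod_def)
    have 2: "(\<Sum>p\<leftarrow>K. (0 :: 'v, t (polar r (fst p) x) (snd p))) = (0, \<Sum>p\<leftarrow>K. t (polar r (fst p) x) (snd p))" for x
      by (induction K) (auto simp: zero_prod_def)
    have "(\<Sum>p\<leftarrow>M. prod_scale s t (polar (orth_sum q r) (fst p) z) (snd p)) =
       (\<Sum>p\<leftarrow>L. (s (polar q (fst p) (fst z)) (snd p), 0)) + (\<Sum>p\<leftarrow>K. (0, t (polar r (fst p) (snd z)) (snd p)))"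
      using z' by (simp add: M_def polar_orth_sum prod_scale_def comp_def)
    also have "\<dots> = z"
      unfolding 1 2 L(2)[OF z'(1), symmetric] K(2)[OF z'(2), symmetric] by (simp add: prod_eq_iff)
    finally show "z = (\<Sum>p\<leftarrow>M. prod_scale s t (polar (orth_sum q r) (fst p) z) (snd p))" by simp
  qed
  moreover have "quad_form (prod_scale s t) (V \<times> W) (orth_sum q r)"
    unfolding quad_form_def polar_orth_sum
    by (auto simp: prod_scale_def orth_sum_def algebra_simps)
  moreover have "P.subspace (V \<times> W)"
    by (auto simp: P.subspace_def prod_scale_def zero_prod_def)
  ultimately show ?thesis
    by unfold_locales (auto simp: X.half)
qed

section \<open>Automorphisms of orthogonal sums\<close>

lemma orth_sum_map_hom:
  "quad_hom s V q s' V' q' f \<Longrightarrow> quad_hom t W r t' W' r' g \<Longrightarrow>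
    quad_hom (prod_scale s t) (V \<times> W) (orth_sum q r) (prod_scale s' t') (V' \<times> W') (orth_sum q' r') (orth_sum_map f g)"
  by (auto simp: quad_hom_def lin_on_def orth_sum_map_def prod_scale_def orth_sum_def)

lemma orth_sum_map_aut:
  assumes "quad_aut s V q f" "quad_aut t W r g"
  shows "quad_aut (prod_scale s t) (V \<times> W) (orth_sum q r) (orth_sum_map f g)"
proof -
  obtain f' where f: "quad_hom s V q s V q f" "quad_hom s V q s V q f'" "\<forall>x\<in>V. f' (f x) = x \<and> f (f' x) = x"
    using assms(1) unfolding quad_aut_def by blast
  obtain g' where g: "quad_hom t W r t W r g" "quad_hom t W r t W r g'" "\<forall>x\<in>W. g' (g x) = x \<and> g (g' x) = x"
    using assms(2) unfolding quad_aut_def by blast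
  show ?thesis
    unfolding quad_aut_def
  proof (intro conjI exI[of _ "orth_sum_map f' g'"] orth_sum_map_hom f g ballI)
    fix p assume "p \<in> V \<times> W"
    then show "orth_sum_map f' g' (orth_sum_map f g p) = p" "orth_sum_map f g (orth_sum_map f' g' p) = p"
      using f(3) g(3) by (auto simp: orth_sum_map_def)
  qed
qed

text \<open>\<open>(x, 0)\<close> is orthogonal to every \<open>(0, y)\<close>, and
  \<open>\<phi>\<close> preserves the polar form and fixes \<open>(0, y)\<close>; so the second
  component of \<open>\<phi> (x, 0)\<close> is orthogonal to all of \<open>W\<close> and vanishes by
  nondegeneracy.\<close>

lemma fixing_summand_hom:
  fixes s :: "'a::comm_ring_1 \<Rightarrow> 'v::ab_group_add \<Rightarrow> 'v" and t :: "'a \<Rightarrow> 'w::ab_group_add \<Rightarrow> 'w"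
  assumes "nonsing_space s V q h" "nonsing_space t W r h"
    and \<phi>: "quad_hom (prod_scale s t) (V \<times> W) (orth_sum q r) (prod_scale s t) (V \<times> W) (orth_sum q r) \<phi>"
    and fixY: "\<forall>y\<in>W. \<phi> (0, y) = (0, y)"
  shows "quad_hom s V q s V q (\<lambda>x. fst (\<phi> (x, 0)))"
    "p \<in> V \<times> W \<Longrightarrow> \<phi> p = orth_sum_map (\<lambda>x. fst (\<phi> (x, 0))) id p"
proof -
  interpret X: nonsing_space s V q h by fact
  interpret Y: nonsing_space t W r h by fact
  interpret P: nonsing_space "prod_scale s t" "V \<times> W" "orth_sum q r" h
    using assms(1,2) by (rule prod_nonsing_space)
  have \<phi>': "\<And>p. p \<in> V \<times> W \<Longrightarrow> \<phi> p \<in> V \<times> W" "\<And>p. p \<in> V \<times> W \<Longrightarrow> orth_sum q r (\<phi> p) = orth_sum q r p"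
    "\<And>p p'. p \<in> V \<times> W \<Longrightarrow> p' \<in> V \<times> W \<Longrightarrow> \<phi> (p + p') = \<phi> p + \<phi> p'"
    "\<And>a p. p \<in> V \<times> W \<Longrightarrow> \<phi> (prod_scale s t a p) = prod_scale s t a (\<phi> p)"
    using \<phi> unfolding quad_hom_def lin_on_def by blast+
  have snd0: "snd (\<phi> (x, 0)) = 0" if x: "x \<in> V" for x
  proof (rule Y.B_nondegenerate)
    have in_P: "(x, 0) \<in> V \<times> W" using x by simp
    then show "snd (\<phi> (x, 0)) \<in> W" using \<phi>'(1) by (auto simp: mem_Times_iff)
    have "fst (\<phi> (x, 0)) \<in> V" using \<phi>'(1)[OF in_P] by (auto simp: mem_Times_iff)
    fix y assume y: "y \<in> W"
    have "polar (orth_sum q r) (\<phi> (x, 0)) (\<phi> (0, y)) = polar (orth_sum q r) (x, 0) (0, y)"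
      using x y by (intro quad_hom_polar[OF \<phi>]) auto
    then show "polar r (snd (\<phi> (x, 0))) y = 0"
      using x y \<open>fst (\<phi> (x, 0)) \<in> V\<close> by (simp add: fixY polar_orth_sum)
  qed
  have \<phi>x: "\<phi> (x, 0) = (fst (\<phi> (x, 0)), 0)" if "x \<in> V" for x
    using snd0[OF that] by (simp add: prod_eq_iff)
  show "quad_hom s V q s V q (\<lambda>x. fst (\<phi> (x, 0)))"
    unfolding quad_hom_def lin_on_def
  proof (intro conjI ballI allI)
    fix x assume x: "x \<in> V"
    then have xP: "(x, 0) \<in> V \<times> W" by simp
    show "fst (\<phi> (x, 0)) \<in> V" using \<phi>'(1)[OF xP] by (auto simp: mem_Times_iff)
    show "q (fst (\<phi> (x, 0))) = q x"
      using \<phi>'(2)[OF xP] snd0[OF x] by (simp add: orth_sum_def)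
    show "fst (\<phi> (s a x, 0)) = s a (fst (\<phi> (x, 0)))" for a
      using \<phi>'(4)[OF xP, of a] by (simp add: prod_scale_def)
    fix y assume y: "y \<in> V"
    then show "fst (\<phi> (x + y, 0)) = fst (\<phi> (x, 0)) + fst (\<phi> (y, 0))"
      using \<phi>'(3)[OF xP, of "(y, 0)"] by simp
  qed
  assume "p \<in> V \<times> W"
  then obtain x y where p: "p = (x, y)" "x \<in> V" "y \<in> W" by auto
  then have "\<phi> p = \<phi> (x, 0) + \<phi> (0, y)" using \<phi>'(3)[of "(x, 0)" "(0, y)"] by simp
  also have "\<dots> = (fst (\<phi> (x, 0)), 0) + (0, y)"
    using \<phi>x[OF p(2)] bspec[OF fixY p(3)] by (rule arg_cong2)
  finally show "\<phi> p = orth_sum_map (\<lambda>x. fst (\<phi> (x, 0))) id p"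
    by (simp add: p(1) orth_sum_map_def)
qed

text \<open>The inverse of \<open>\<phi>\<close> fixes \<open>W\<close> as well, so
  \<open>fixing_summand_hom\<close> applies to both, and the two induced maps on \<open>V\<close>
  are mutually inverse.\<close>

lemma fixing_summand_aut:
  fixes s :: "'a::comm_ring_1 \<Rightarrow> 'v::ab_group_add \<Rightarrow> 'v" and t :: "'a \<Rightarrow> 'w::ab_group_add \<Rightarrow> 'w"
  assumes XY: "nonsing_space s V q h" "nonsing_space t W r h"
    and \<phi>: "quad_aut (prod_scale s t) (V \<times> W) (orth_sum q r) \<phi>"
    and fixY: "\<forall>y\<in>W. \<phi> (0, y) = (0, y)"
  shows "\<exists>f. quad_aut s V q f \<and> (\<forall>p\<in>V \<times> W. \<phi> p = orth_sum_map f id p)"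
proof -
  interpret X: nonsing_space s V q h by fact
  interpret Y: nonsing_space t W r h by fact
  obtain \<psi> where h: "quad_hom (prod_scale s t) (V \<times> W) (orth_sum q r) (prod_scale s t) (V \<times> W) (orth_sum q r) \<phi>"
    "quad_hom (prod_scale s t) (V \<times> W) (orth_sum q r) (prod_scale s t) (V \<times> W) (orth_sum q r) \<psi>"
    and inv: "\<forall>p\<in>V \<times> W. \<psi> (\<phi> p) = p \<and> \<phi> (\<psi> p) = p"
    using \<phi> unfolding quad_aut_def by blast
  have fixY': "\<forall>y\<in>W. \<psi> (0, y) = (0, y)"
    using fixY inv by (metis SigmaI X.closed(1))
  define f where "f = (\<lambda>x. fst (\<phi> (x, 0)))"
  define g where "g = (\<lambda>x. fst (\<psi> (x, 0)))"
  note F = fixing_summand_hom[OF XY h(1) fixY, folded f_def]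
  note G = fixing_summand_hom[OF XY h(2) fixY', folded g_def]
  have "g (f x) = x \<and> f (g x) = x" if x: "x \<in> V" for x
  proof -
    have xP: "(x, 0) \<in> V \<times> W" using x by simp
    have "f x \<in> V" "g x \<in> V" using F(1) G(1) x unfolding quad_hom_def by blast+
    then have fgP: "(f x, 0) \<in> V \<times> W" "(g x, 0) \<in> V \<times> W" by simp_all
    have "\<phi> (x, 0) = (f x, 0)" "\<psi> (x, 0) = (g x, 0)"
      using F(2)[OF xP] G(2)[OF xP] by (simp_all add: orth_sum_map_def)
    moreover have "\<phi> (g x, 0) = (f (g x), 0)" "\<psi> (f x, 0) = (g (f x), 0)"
      using F(2)[OF fgP(2)] G(2)[OF fgP(1)] by (simp_all add: orth_sum_map_def)
    ultimately show ?thesis using inv xP by (metis fst_conv)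
  qed
  then have "quad_aut s V q f" unfolding quad_aut_def using F(1) G(1) by blast
  then show ?thesis using F(2) by blast
qed

theorem theorem3p3:
  fixes sZ :: "'a::comm_ring_1 \<Rightarrow> 'z::ab_group_add \<Rightarrow> 'z"
    and sX :: "'a \<Rightarrow> 'x::ab_group_add \<Rightarrow> 'x"
    and sY :: "'a \<Rightarrow> 'y::ab_group_add \<Rightarrow> 'y"
    and VX :: "'x set" and qX :: "'x \<Rightarrow> 'a"
    and VY :: "'y set" and qY :: "'y \<Rightarrow> 'a"
  assumes semiloc: "semi_local TYPE('a)"
    and two_unit: "(2::'a) dvd 1"
    and modZ: "module sZ" and modX: "module sX" and modY: "module sY"
    and X: "quad_module sX VX qX"
    and Y: "quad_module sY VY qY"
  shows
    \<comment> \<open>the zero module is an object and is initial\<close>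
    "(quad_module sZ {0} (\<lambda>_. 0) \<and>
      (\<exists>f. quad_hom sZ {0} (\<lambda>_. 0) sX VX qX f) \<and>
      (\<forall>f g. quad_hom sZ {0} (\<lambda>_. 0) sX VX qX f \<and> quad_hom sZ {0} (\<lambda>_. 0) sX VX qX g
          \<longrightarrow> (\<forall>z\<in>{0}. f z = g z)))
     \<comment> \<open>(H1)\<close>
     \<and> (\<forall>f g. quad_hom sX VX qX sY VY qY f \<and> quad_hom sX VX qX sY VY qY g \<longrightarrow>
          (\<exists>\<phi>. quad_aut sY VY qY \<phi> \<and> (\<forall>x\<in>VX. \<phi> (f x) = g x)))
     \<comment> \<open>(H2)\<close>
     \<and> quad_module (prod_scale sX sY) (VX \<times> VY) (orth_sum qX qY)
     \<and> (\<forall>f. quad_aut sX VX qX f \<longrightarrow>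
          quad_aut (prod_scale sX sY) (VX \<times> VY) (orth_sum qX qY) (orth_sum_map f id))
     \<and> (\<forall>f f'. quad_aut sX VX qX f \<and> quad_aut sX VX qX f' \<and>
          (\<forall>p\<in>VX \<times> VY. orth_sum_map f id p = orth_sum_map f' id p) \<longrightarrow> (\<forall>x\<in>VX. f x = f' x))
     \<and> (\<forall>\<phi>. quad_aut (prod_scale sX sY) (VX \<times> VY) (orth_sum qX qY) \<phi> \<longrightarrow>
          ((\<forall>y\<in>VY. \<phi> (0, y) = (0, y)) \<longleftrightarrow>
           (\<exists>f. quad_aut sX VX qX f \<and> (\<forall>p\<in>VX \<times> VY. \<phi> p = orth_sum_map f id p))))"
proof -
  obtain h :: 'a where h: "2 * h = 1" using two_unit by (metis dvdE)
  have nX: "nonsing_space sX VX qX h" and nY: "nonsing_space sY VY qY h"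
    using nonsing_space_of_quad_module modX modY X Y h by blast+
  interpret Z: module sZ by fact
  interpret X: nonsing_space sX VX qX h by fact
  interpret Y: nonsing_space sY VY qY h by fact
  have zero: "quad_module sZ {0} (\<lambda>_. 0)"
    using nonsing_space.quad_module[OF zero_nonsing_space[OF modZ h]] .
  have init: "\<exists>f. quad_hom sZ {0} (\<lambda>_. 0) sX VX qX f"
    using X.q_scale[of 0 0] by (intro exI[of _ "\<lambda>_. 0"]) (simp add: quad_hom_def lin_on_def)
  have init_unique: "f 0 = 0" if "quad_hom sZ {0} (\<lambda>_. 0) sX VX qX f" for f
  proof -
    have "f (0 + 0) = f 0 + f 0" using that unfolding quad_hom_def lin_on_def by blast
    then show ?thesis by simp
  qed
  have H1: "\<exists>\<phi>. quad_aut sY VY qY \<phi> \<and> (\<forall>x\<in>VX. \<phi> (f x) = g x)"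
    if "quad_hom sX VX qX sY VY qY f" "quad_hom sX VX qX sY VY qY g" for f g
  proof -
    obtain n where "\<And>m. ring_ideal m \<Longrightarrow> detecting m VX qX n" using X.detecting_frame by blast
    then have "\<And>m. maximal_ideal m \<Longrightarrow> detecting m VX qX n" using maximal_ideal_ideal by blast
    then show ?thesis by (rule witt_extension[OF semiloc nX nY _ that])
  qed
  have sum: "quad_module (prod_scale sX sY) (VX \<times> VY) (orth_sum qX qY)"
    using nonsing_space.quad_module[OF prod_nonsing_space[OF nX nY]] .
  have H2_hom: "quad_aut (prod_scale sX sY) (VX \<times> VY) (orth_sum qX qY) (orth_sum_map f id)"
    if "quad_aut sX VX qX f" for f
    using orth_sum_map_aut[OF that quad_aut_id] by (simp add: id_def)
  have H2_inj: "f x = f' x"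
    if "\<forall>p\<in>VX \<times> VY. orth_sum_map f id p = orth_sum_map f' id p" "x \<in> VX" for f f' and x
    using bspec[OF that(1), of "(x, 0)"] that(2) by (simp add: orth_sum_map_def)
  have H2_image: "(\<forall>y\<in>VY. \<phi> (0, y) = (0, y)) \<longleftrightarrow>
      (\<exists>f. quad_aut sX VX qX f \<and> (\<forall>p\<in>VX \<times> VY. \<phi> p = orth_sum_map f id p))"
    if \<phi>: "quad_aut (prod_scale sX sY) (VX \<times> VY) (orth_sum qX qY) \<phi>" for \<phi>
  proof
    assume "\<forall>y\<in>VY. \<phi> (0, y) = (0, y)"
    then show "\<exists>f. quad_aut sX VX qX f \<and> (\<forall>p\<in>VX \<times> VY. \<phi> p = orth_sum_map f id p)"
      by (rule fixing_summand_aut[OF nX nY \<phi>])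
  next
    assume "\<exists>f. quad_aut sX VX qX f \<and> (\<forall>p\<in>VX \<times> VY. \<phi> p = orth_sum_map f id p)"
    then obtain f where f: "quad_aut sX VX qX f" "\<forall>p\<in>VX \<times> VY. \<phi> p = orth_sum_map f id p" by blast
    have "f (0 + 0) = f 0 + f 0"
      using quad_aut_hom[OF f(1)] X.closed(1) unfolding quad_hom_def lin_on_def by blast
    then have "f 0 = 0" by simp
    then show "\<forall>y\<in>VY. \<phi> (0, y) = (0, y)"
      using f(2) by (simp add: orth_sum_map_def)
  qed
  show ?thesis
    by (intro conjI allI impI ballI; (elim conjE)?)
      (rule zero, rule init, simp add: init_unique, rule H1, assumption+, rule sum,
        rule H2_hom, assumption, rule H2_inj, assumption+, rule H2_image, assumption)
qed

end
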